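(* Let $c\in\mathbb{R}$, let $u:\mathbb{R}\to\mathbb{R}$ be a smooth odd function with $u'(0)\neq0$ satisfying $$r^2u''+(6-cr^2)\,r\,u'-6\sin u=0,$$ and let $\varphi=\varphi(f,X)$ be the $\mathrm{G}_2$-structure on $\mathbb{R}^7$ isometric to the standard torsion-free $\mathrm{G}_2$-structure $\overline{\varphi}$ given by $f=\cos(\frac12u(r))$, $X=\sin(\frac12u(r))\frac{\partial}{\partial r}$, where $r$ is the distance to the origin (so that $(\varphi,\,c\,r\frac{\partial}{\partial r},\,c)$ is a radially symmetric soliton for the isometric flow on Euclidean $\mathbb{R}^7$). Let $T$ be the torsion of $\varphi$. If $c\le0$ then $\lim_{r\to\infty}|T|^2=0$. If $c>0$ then $\lim_{r\to\infty}|T|^2=\infty$.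
   Context: Conventions. A $\mathrm{G}_2$-structure $\varphi$ on a 7-manifold induces a Riemannian metric $g$, an orientation, and $\psi=\star\varphi$; the sign convention is $\varphi_{ijk}\varphi_{abk}=\delta_{ia}\delta_{jb}-\delta_{ib}\delta_{ja}-\psi_{ijab}$ in local orthonormal frames (repeated indices summed). With $\nabla$ the Levi-Civita connection, the torsion $T_{pq}$ is defined by $\nabla_p\varphi_{ijk}=T_{pq}\psi_{qijk}$, and $|T|^2=T_{pq}T_{pq}$. Set $(\operatorname{div}T)_k=\nabla_iT_{ik}$, $(Y\lrcorner T)_k=Y_pT_{pk}$, $(\operatorname{curl}_\varphi Y)_k=\nabla_iY_j\varphi_{ijk}$. Given $\overline{\varphi}$ with $\overline{\psi}=\star\overline{\varphi}$ and a pair $(f,X)$ of a function and a vector field with $f^2+|X|^2=1$, the isometric $\mathrm{G}_2$-structure is $$\varphi(f,X)=(f^2-|X|^2)\overline{\varphi}-2f\,X\lrcorner\overline{\psi}+2X^\flat\wedge(X\lrcorner\overline{\varphi}).$$ A soliton for the isometric flow $\partial_t\varphi=(\operatorname{div}T)\lrcorner\psi$ is a triple $(\varphi,Y,c)$ with $\mathcal{L}_Yg=2c\,g$ and $\operatorname{div}T=-\frac12\operatorname{curl}_\varphi Y+Y\lrcorner T$. For the $\varphi$ in the claim one has $|T|^2=(u')^2+24\,r^{-2}\sin^2(\frac12u)$. *)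

theory Defs
  imports "HOL-Analysis.Analysis"
begin

text \<open>
  Tensors on Euclidean \<open>\<real>\<^sup>7\<close> are given by their components in the standard orthonormal coordinates
  \<open>x\<^sub>1, \<dots>, x\<^sub>7\<close>, and a tensor field is a function of the point. The index type is \<^typ>\<open>7\<close>, in
  which the numeral \<open>7\<close> denotes the same element as \<open>0\<close>; hence \<open>1, \<dots>, 7\<close> are its seven elements.
\<close>

type_synonym form1 = "7 \<Rightarrow> real"
type_synonym form2 = "7 \<Rightarrow> 7 \<Rightarrow> real"
type_synonym form3 = "7 \<Rightarrow> 7 \<Rightarrow> 7 \<Rightarrow> real"
type_synonym form4 = "7 \<Rightarrow> 7 \<Rightarrow> 7 \<Rightarrow> 7 \<Rightarrow> real"

definition wedge11 :: "form1 \<Rightarrow> form1 \<Rightarrow> form2" where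
  "wedge11 \<alpha> \<beta> i j = \<alpha> i * \<beta> j - \<alpha> j * \<beta> i"

definition wedge12 :: "form1 \<Rightarrow> form2 \<Rightarrow> form3" where
  "wedge12 \<alpha> \<beta> i j k = \<alpha> i * \<beta> j k + \<alpha> j * \<beta> k i + \<alpha> k * \<beta> i j"

definition interior3 :: "real ^ 7 \<Rightarrow> form3 \<Rightarrow> form2" where
  "interior3 X \<alpha> j k = (\<Sum>i\<in>UNIV. X $ i * \<alpha> i j k)"

definition interior4 :: "real ^ 7 \<Rightarrow> form4 \<Rightarrow> form3" where
  "interior4 X \<alpha> j k l = (\<Sum>i\<in>UNIV. X $ i * \<alpha> i j k l)"

definition flat :: "real ^ 7 \<Rightarrow> form1" where
  "flat X i = X $ i"

definition dx :: "7 \<Rightarrow> form1" where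
  "dx a i = (if i = a then 1 else 0)"

definition dx3 :: "7 \<Rightarrow> 7 \<Rightarrow> 7 \<Rightarrow> form3" where
  "dx3 a b c = wedge12 (dx a) (wedge11 (dx b) (dx c))"

text \<open>
  The volume form of the Euclidean metric and the orientation
  \<open>dx\<^sub>1 \<and> \<dots> \<and> dx\<^sub>7\<close>, i.e. the Levi-Civita symbol.
\<close>

definition vol7 :: "7 \<Rightarrow> 7 \<Rightarrow> 7 \<Rightarrow> 7 \<Rightarrow> 7 \<Rightarrow> 7 \<Rightarrow> 7 \<Rightarrow> real" where
  "vol7 a b c i j k l =
    det (vector [axis a 1, axis b 1, axis c 1, axis i 1, axis j 1, axis k 1, axis l 1]
      :: real ^ 7 ^ 7)"

definition hodge3 :: "form3 \<Rightarrow> form4" where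
  "hodge3 \<alpha> i j k l =
    (\<Sum>a\<in>UNIV. \<Sum>b\<in>UNIV. \<Sum>c\<in>UNIV. vol7 a b c i j k l * \<alpha> a b c) / 6"

text \<open>
  The standard \<open>G\<^sub>2\<close>-form. The signs are those for which, with \<open>\<psi> = hodge3 \<phi>\<close> for the orientation
  fixed above,
  \<open>\<Sum>\<^sub>k \<phi>\<^sub>i\<^sub>j\<^sub>k \<phi>\<^sub>a\<^sub>b\<^sub>k = \<delta>\<^sub>i\<^sub>a \<delta>\<^sub>j\<^sub>b - \<delta>\<^sub>i\<^sub>b \<delta>\<^sub>j\<^sub>a - \<psi>\<^sub>i\<^sub>j\<^sub>a\<^sub>b\<close>.
\<close>

definition phi_std :: form3 where
  "phi_std i j k =
    dx3 1 2 3 i j k - dx3 1 6 7 i j k - dx3 5 2 7 i j k - dx3 5 6 3 i j k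
    - dx3 4 1 5 i j k - dx3 4 2 6 i j k - dx3 4 3 7 i j k"

text \<open>
  \<open>\<phi>(f, X)\<close> at a single point. It is meant for \<open>f\<^sup>2 + |X|\<^sup>2 = 1\<close>; it is then a
  \<open>G\<^sub>2\<close>-form with the same metric and orientation as \<open>\<phi>\<close>.
\<close>

definition g2_isometric :: "form3 \<Rightarrow> real \<Rightarrow> real ^ 7 \<Rightarrow> form3" where
  "g2_isometric \<phi> f X i j k =
    (f\<^sup>2 - (norm X)\<^sup>2) * \<phi> i j k
    - 2 * f * interior4 X (hodge3 \<phi>) i j k
    + 2 * wedge12 (flat X) (interior3 X \<phi>) i j k"

text \<open>
  The Levi-Civita connection of the Euclidean metric acts on components by partial derivatives.
\<close>

definition nabla3 :: "(real ^ 7 \<Rightarrow> form3) \<Rightarrow> real ^ 7 \<Rightarrow> 7 \<Rightarrow> form3" where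
  "nabla3 \<phi> x p i j k = deriv (\<lambda>t. \<phi> (x + t *\<^sub>R axis p 1) i j k) 0"

text \<open>
  Torsion, and its squared norm, of a \<open>G\<^sub>2\<close>-structure that induces the Euclidean metric and the
  standard orientation, so that \<open>\<nabla>\<close> and \<open>\<star>\<close> are the Euclidean ones above.
\<close>

definition torsion :: "(real ^ 7 \<Rightarrow> form3) \<Rightarrow> real ^ 7 \<Rightarrow> 7 \<Rightarrow> 7 \<Rightarrow> real" where
  "torsion \<phi> x =
    (THE T. \<forall>p i j k. nabla3 \<phi> x p i j k = (\<Sum>q\<in>UNIV. T p q * hodge3 (\<phi> x) q i j k))"

definition torsion_norm_sq :: "(real ^ 7 \<Rightarrow> form3) \<Rightarrow> real ^ 7 \<Rightarrow> real" where
  "torsion_norm_sq \<phi> x = (\<Sum>p\<in>UNIV. \<Sum>q\<in>UNIV. (torsion \<phi> x p q)\<^sup>2)"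

text \<open>
  \<open>sgn x = x /\<^sub>R norm x\<close> is the radial unit vector field \<open>\<partial>/\<partial>r\<close>. Its junk value \<open>sgn 0 = 0\<close> gives
  \<open>X = 0\<close> at the origin, which for odd smooth \<open>u\<close> is the value of the smooth extension of \<open>X\<close>.
\<close>

definition radial_f :: "(real \<Rightarrow> real) \<Rightarrow> real ^ 7 \<Rightarrow> real" where
  "radial_f u x = cos (u (norm x) / 2)"

definition radial_X :: "(real \<Rightarrow> real) \<Rightarrow> real ^ 7 \<Rightarrow> real ^ 7" where
  "radial_X u x = sin (u (norm x) / 2) *\<^sub>R sgn x"

definition radial_g2 :: "(real \<Rightarrow> real) \<Rightarrow> real ^ 7 \<Rightarrow> form3" where
  "radial_g2 u x = g2_isometric phi_std (radial_f u x) (radial_X u x)"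

definition smooth :: "(real \<Rightarrow> real) \<Rightarrow> bool" where
  "smooth u \<longleftrightarrow> (\<forall>n r. (deriv ^^ n) u differentiable (at r))"

end

theory Submission
  imports Defs "HOL-Real_Asymp.Real_Asymp"
begin

text \<open>
  The theorem splits into an algebraic computation of \<open>|T|\<^sup>2\<close> and an analysis of the profile
  equation.

  Torsion. Away from the origin write \<open>e = \<partial>/\<partial>r\<close> and \<open>t = u(r)\<close>. The form \<open>\<phi>(f, X)\<close> is
  \<open>cos t \<phi> - sin t (e \<lrcorner> \<psi>) + (1 - cos t) e \<and> (e \<lrcorner> \<phi>)\<close>: the part of \<open>\<phi>\<close> that is a multiple of
  \<open>e\<close> stays, and the phase of the complex volume form on \<open>e\<^sup>\<bottom>\<close> is rotated by \<open>t\<close>. Its Hodge dual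
  is \<open>\<psi>' = \<psi> - (1 - cos t) e \<and> (e \<lrcorner> \<psi>) + sin t e \<and> \<phi>\<close> (\<open>hodge3_phi_rot\<close>). Moving in the
  direction \<open>a\<close> changes \<open>t\<close> at the rate \<open>u' (e \<bullet> a)\<close> and \<open>e\<close> at the rate \<open>w = (a - (e \<bullet> a) e) / r\<close>,
  and in both cases the variation of the form is \<open>Z \<lrcorner> \<psi>'\<close> for an explicit vector \<open>Z\<close>, namely
  \<open>- e\<close> for the angle and \<open>- sin t w + (1 - cos t) e \<times> w\<close> for the axis. As \<open>Z \<mapsto> Z \<lrcorner> \<psi>'\<close>
  is injective, this determines \<open>T\<close>; summing the squares over a basis gives
  \<open>|T|\<^sup>2 = u'\<^sup>2 + 24 sin\<^sup>2(u/2) / r\<^sup>2\<close> (\<open>torsion_norm_sq_radial_g2\<close>).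

  All of this is algebra of the seven-dimensional cross product \<open>\<times>\<close>, with \<open>\<phi>(a, b, c) = (a \<times> b) \<bullet> c\<close>.
  It uses only bilinearity, skewness, cyclicity and \<open>|a \<times> b|\<^sup>2 = |a|\<^sup>2|b|\<^sup>2 - (a \<bullet> b)\<^sup>2\<close>, so it is
  carried out for an abstract vector cross product. The components of the standard form are used twice: to
  check these laws, and to identify \<open>\<star>\<phi>\<close> with the four-form defined by the cross product. The Hodge
  duals of the two remaining pieces of \<open>\<phi>(f, X)\<close> follow from the \<open>gl(7)\<close>-equivariance
  of \<open>\<star>\<close> up to the trace (\<open>hodge3_derivation\<close>), since both pieces arise from \<open>\<phi>\<close> by derivations.

  Profile for \<open>c \<le> 0\<close>. In the variable \<open>log r\<close> the equation is a damped pendulum: the energy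
  \<open>(r u')\<^sup>2/2 + 6 cos u\<close> decreases, so \<open>r u'\<close> is bounded and \<open>|T|\<^sup>2 = O(r\<^sup>-\<^sup>2)\<close>.

  Profile for \<open>c > 0\<close>. The danger is a bounded solution, a self-similar shrinker. Differentiating the
  equation in \<open>log r\<close> shows that \<open>r u'\<close> solves a linear equation whose potential
  \<open>- 6 cos u - 2 c r\<^sup>2\<close> is at most \<open>6 - 2 c r\<^sup>2\<close>. For the latter potential the positive function
  \<open>r\<^sup>-\<^sup>2\<close> is a solution; this is where the dimension matters. Sturm comparison of the two, that is, the study of the quotient
  \<open>p = r\<^sup>3 u'\<close>, gives \<open>(r\<^sup>2 e\<^bsup>-cr\<^sup>2/2\<^esup> p')' = 6 (1 + cos u) e\<^bsup>-cr\<^sup>2/2\<^esup> p\<close>. If \<open>u'(0) > 0\<close>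
  then \<open>p\<close> stays positive, the bracket stays above a positive constant, and \<open>p'\<close> grows like
  \<open>e\<^bsup>cr\<^sup>2/2\<^esup> / r\<^sup>2\<close>; hence \<open>u' \<rightarrow> \<infinity>\<close>. The case \<open>u'(0) < 0\<close> follows by replacing \<open>u\<close> with \<open>-u\<close>.
\<close>

section \<open>Vector cross products\<close>

text \<open>
  The four-form of a cross product. For the octonionic cross product this formula is the contraction
  identity \<open>\<phi>\<^sub>i\<^sub>j\<^sub>k \<phi>\<^sub>a\<^sub>b\<^sub>k = \<delta>\<^sub>i\<^sub>a \<delta>\<^sub>j\<^sub>b - \<delta>\<^sub>i\<^sub>b \<delta>\<^sub>j\<^sub>a - \<psi>\<^sub>i\<^sub>j\<^sub>a\<^sub>b\<close> read as a definition of \<open>\<psi>\<close>.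
\<close>

definition cross_psi :: "('a::real_inner \<Rightarrow> 'a \<Rightarrow> 'a) \<Rightarrow> 'a \<Rightarrow> 'a \<Rightarrow> 'a \<Rightarrow> 'a \<Rightarrow> real" where
  "cross_psi cr a b c d = (a \<bullet> c) * (b \<bullet> d) - (a \<bullet> d) * (b \<bullet> c) - cr a b \<bullet> cr c d"

text \<open>
  The four-form \<open>e\<^sup>\<flat> \<and> \<beta>\<close> for an alternating three-form \<open>\<beta>\<close>.
\<close>

definition wedge1 :: "'a::real_inner \<Rightarrow> ('a \<Rightarrow> 'a \<Rightarrow> 'a \<Rightarrow> real) \<Rightarrow> 'a \<Rightarrow> 'a \<Rightarrow> 'a \<Rightarrow> 'a \<Rightarrow> real" where
  "wedge1 e \<beta> p q r s = (e \<bullet> p) * \<beta> q r s - (e \<bullet> q) * \<beta> p r s + (e \<bullet> r) * \<beta> p q s - (e \<bullet> s) * \<beta> p q r"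

locale vector_cross_product =
  fixes cr :: "'a::real_inner \<Rightarrow> 'a \<Rightarrow> 'a"  (infixl "\<odot>" 75)
  assumes bilinear_cr: "bilinear (\<odot>)"
    and skew: "a \<odot> b = - (b \<odot> a)"
    and cyclic: "(a \<odot> b) \<bullet> c = (b \<odot> c) \<bullet> a"
    and lagrange: "(a \<odot> b) \<bullet> (a \<odot> c) = (a \<bullet> a) * (b \<bullet> c) - (a \<bullet> b) * (a \<bullet> c)"
begin

abbreviation phi where "phi a b c \<equiv> (a \<odot> b) \<bullet> c"
abbreviation psi where "psi \<equiv> cross_psi (\<odot>)"

lemma cr_linear:
  "(a + b) \<odot> c = a \<odot> c + b \<odot> c" "c \<odot> (a + b) = c \<odot> a + c \<odot> b"
  "(r *\<^sub>R a) \<odot> c = r *\<^sub>R (a \<odot> c)" "c \<odot> (r *\<^sub>R a) = r *\<^sub>R (c \<odot> a)"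
  "(a - b) \<odot> c = a \<odot> c - b \<odot> c" "c \<odot> (a - b) = c \<odot> a - c \<odot> b"
  "(- a) \<odot> c = - (a \<odot> c)" "c \<odot> (- a) = - (c \<odot> a)"
  "0 \<odot> c = 0" "c \<odot> 0 = 0"
  using bilinear_cr
  by (simp_all add: bilinear_ladd bilinear_radd bilinear_lmul bilinear_rmul bilinear_lsub
      bilinear_rsub bilinear_lneg bilinear_rneg bilinear_lzero bilinear_rzero)

lemma cr_self: "a \<odot> a = 0"
proof -
  have "2 *\<^sub>R (a \<odot> a) = 0"
    using skew[of a a] by (metis add.right_inverse scaleR_2)
  then show ?thesis
    by simp
qed

lemma cr_orthogonal: "(a \<odot> b) \<bullet> a = 0" "(a \<odot> b) \<bullet> b = 0"
  using cyclic[of a b b] cyclic[of b a a] skew[of a b] by (simp_all add: cr_self)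

lemma lagrange_polarized:
  "(a \<odot> b) \<bullet> (c \<odot> d) + (c \<odot> b) \<bullet> (a \<odot> d)
    = 2 * (a \<bullet> c) * (b \<bullet> d) - (a \<bullet> b) * (c \<bullet> d) - (c \<bullet> b) * (a \<bullet> d)"
  using lagrange[of "a + c" b d] lagrange[of a b d] lagrange[of c b d]
  by (simp add: cr_linear inner_add_left inner_add_right inner_commute[of c a] algebra_simps)

lemma cr_cr: "a \<odot> (a \<odot> b) = (a \<bullet> b) *\<^sub>R a - (a \<bullet> a) *\<^sub>R b"
proof (rule vector_eq_rdot[THEN iffD1], rule allI)
  fix z
  have "(a \<odot> (a \<odot> b)) \<bullet> z = (z \<odot> a) \<bullet> (a \<odot> b)"
    using cyclic[of z a "a \<odot> b"] by simp
  also have "\<dots> = - ((a \<odot> z) \<bullet> (a \<odot> b))"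
    by (subst skew) simp
  finally show "(a \<odot> (a \<odot> b)) \<bullet> z = ((a \<bullet> b) *\<^sub>R a - (a \<bullet> a) *\<^sub>R b) \<bullet> z"
    unfolding lagrange by (simp add: inner_diff_left inner_commute[of z b])
qed

text \<open>
  The outer two antisymmetries are visible in the definition; the middle one is the polarized Lagrange
  identity, and with it \<open>\<psi>\<close> is alternating.
\<close>

lemma psi_swap:
  "psi a b c d = - psi b a c d"
  "psi a b c d = - psi a c b d"
  "psi a b c d = - psi a b d c"
proof -
  show "psi a b c d = - psi b a c d"
    unfolding cross_psi_def by (subst skew[of a b]) (simp add: algebra_simps)
  show "psi a b c d = - psi a b d c"
    unfolding cross_psi_def by (subst skew[of c d]) (simp add: algebra_simps)
  show "psi a b c d = - psi a c b d"
    unfolding cross_psi_def skew[of a b] skew[of a c]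
    using lagrange_polarized[of b a c d] by (simp add: inner_commute algebra_simps)
qed

lemma psi_linear1:
  "psi (a + b) x y z = psi a x y z + psi b x y z"
  "psi (r *\<^sub>R a) x y z = r * psi a x y z"
  "psi (- a) x y z = - psi a x y z"
  by (simp_all add: cross_psi_def cr_linear inner_add_left algebra_simps)

text \<open>
  By cyclicity \<open>((x \<times> y) \<times> a) \<bullet> (b \<times> c)\<close> and \<open>((b \<times> c) \<times> a) \<bullet> (x \<times> y)\<close> are opposite,
  so exchanging the pair under the cross product with a disjoint pair changes the sign of
  \<open>\<psi>(x \<times> y, a, b, c)\<close> up to terms of lower complexity.
\<close>

lemma psi_cr_swap:
  "psi (x \<odot> y) a b c + psi (b \<odot> c) a x y
     = phi x y b * (a \<bullet> c) - phi x y c * (a \<bullet> b) + phi b c x * (a \<bullet> y) - phi b c y * (a \<bullet> x)"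
proof -
  have "((x \<odot> y) \<odot> a) \<bullet> (b \<odot> c) = (a \<odot> (b \<odot> c)) \<bullet> (x \<odot> y)"
    by (rule cyclic)
  also have "\<dots> = - (((b \<odot> c) \<odot> a) \<bullet> (x \<odot> y))"
    by (subst skew) simp
  finally show ?thesis
    unfolding cross_psi_def by simp
qed

lemma phi_perm:
  "phi a b c = - phi b a c" "phi a b c = phi b c a" "phi a b c = phi c a b" "phi a b c = - phi a c b"
proof -
  show "phi a b c = - phi b a c"
    by (subst skew) simp
  show "phi a b c = phi b c a"
    by (rule cyclic)
  show "phi a b c = phi c a b"
    using cyclic[of c a b] by simp
  show "phi a b c = - phi a c b"
    using cyclic[of b a c] by (subst skew) simp
qed

text \<open>
  The contraction identity for \<open>\<phi>\<^sub>i\<^sub>j\<^sub>k \<psi>\<^sub>k\<^sub>a\<^sub>b\<^sub>c\<close>. Exchanging disjoint pairs among the five letters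
  \<open>x, y, a, b, c\<close> along the cycle \<open>xy, bc, ax, yb, ca, xy\<close> of odd length returns to the initial term with
  the opposite sign, so the exchange rule determines it.
\<close>

lemma psi_cr:
  "psi (x \<odot> y) a b c =
    - ((x \<bullet> a) * phi y b c + (x \<bullet> b) * phi y c a + (x \<bullet> c) * phi y a b)
    + ((y \<bullet> a) * phi x b c + (y \<bullet> b) * phi x c a + (y \<bullet> c) * phi x a b)"
proof -
  have 1: "psi (x \<odot> y) a b c + psi (b \<odot> c) a x y
     = phi x y b * (a \<bullet> c) - phi x y c * (a \<bullet> b) + phi b c x * (a \<bullet> y) - phi b c y * (a \<bullet> x)"
    by (rule psi_cr_swap)
  have 2: "psi (b \<odot> c) y a x + psi (a \<odot> x) y b c
     = phi b c a * (y \<bullet> x) - phi b c x * (y \<bullet> a) + phi a x b * (y \<bullet> c) - phi a x c * (y \<bullet> b)"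
    by (rule psi_cr_swap)
  have 3: "psi (a \<odot> x) c y b + psi (y \<odot> b) c a x
     = phi a x y * (c \<bullet> b) - phi a x b * (c \<bullet> y) + phi y b a * (c \<bullet> x) - phi y b x * (c \<bullet> a)"
    by (rule psi_cr_swap)
  have 4: "psi (y \<odot> b) x c a + psi (c \<odot> a) x y b
     = phi y b c * (x \<bullet> a) - phi y b a * (x \<bullet> c) + phi c a y * (x \<bullet> b) - phi c a b * (x \<bullet> y)"
    by (rule psi_cr_swap)
  have 5: "psi (c \<odot> a) b x y + psi (x \<odot> y) b c a
     = phi c a x * (b \<bullet> y) - phi c a y * (b \<bullet> x) + phi x y c * (b \<bullet> a) - phi x y a * (b \<bullet> c)"
    by (rule psi_cr_swap)
  have cyc: "psi v p q r = psi v q r p" for v p q r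
    using psi_swap(2)[of v p q r] psi_swap(3)[of v q p r] by simp
  have 6: "psi (b \<odot> c) y a x = psi (b \<odot> c) a x y" "psi (a \<odot> x) c y b = psi (a \<odot> x) y b c"
    "psi (y \<odot> b) x c a = psi (y \<odot> b) c a x" "psi (c \<odot> a) b x y = psi (c \<odot> a) x y b"
    "psi (x \<odot> y) b c a = psi (x \<odot> y) a b c"
    by (rule cyc cyc[symmetric])+
  have inn: "a \<bullet> x = x \<bullet> a" "b \<bullet> x = x \<bullet> b" "c \<bullet> x = x \<bullet> c" "a \<bullet> y = y \<bullet> a" "b \<bullet> y = y \<bullet> b" "c \<bullet> y = y \<bullet> c" "y \<bullet> x = x \<bullet> y"
     "b \<bullet> a = a \<bullet> b" "c \<bullet> a = a \<bullet> c" "c \<bullet> b = b \<bullet> c"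
    by (simp_all add: inner_commute)
  have ph: "phi b c x = phi x b c" "phi b c y = phi y b c" "phi b c a = phi a b c"
     "phi a x b = - phi x a b" "phi a x c = phi x c a" "phi a x y = phi x y a" "phi y b a = - phi y a b"
     "phi y b x = phi x y b" "phi c a y = phi y c a" "phi c a b = phi a b c" "phi c a x = phi x c a"
    by (rule phi_perm)+
  \<comment> \<open>The alternating sum of the five relations telescopes.\<close>
  have "2 * psi (x \<odot> y) a b c =
    (phi x y b * (a \<bullet> c) - phi x y c * (a \<bullet> b) + phi b c x * (a \<bullet> y) - phi b c y * (a \<bullet> x))
    - (phi b c a * (y \<bullet> x) - phi b c x * (y \<bullet> a) + phi a x b * (y \<bullet> c) - phi a x c * (y \<bullet> b))
    + (phi a x y * (c \<bullet> b) - phi a x b * (c \<bullet> y) + phi y b a * (c \<bullet> x) - phi y b x * (c \<bullet> a))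
    - (phi y b c * (x \<bullet> a) - phi y b a * (x \<bullet> c) + phi c a y * (x \<bullet> b) - phi c a b * (x \<bullet> y))
    + (phi c a x * (b \<bullet> y) - phi c a y * (b \<bullet> x) + phi x y c * (b \<bullet> a) - phi x y a * (b \<bullet> c))"
    unfolding 1[symmetric] 2[symmetric] 3[symmetric] 4[symmetric] 5[symmetric] 6 by simp
  then show ?thesis
    unfolding inn ph(1-11) by (simp add: algebra_simps)
qed

definition phi_wedge :: "'a \<Rightarrow> 'a \<Rightarrow> 'a \<Rightarrow> 'a \<Rightarrow> 'a \<Rightarrow> real" where
  "phi_wedge x y a b c = (x \<bullet> a) * phi y b c + (x \<bullet> b) * phi y c a + (x \<bullet> c) * phi y a b"

text \<open>
  The form \<open>\<phi>(f, X)\<close> for \<open>f = cos (t/2)\<close>, \<open>X = sin (t/2) e\<close> and a unit vector \<open>e\<close>, and its Hodge dual.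
\<close>

definition phi_rot :: "real \<Rightarrow> 'a \<Rightarrow> 'a \<Rightarrow> 'a \<Rightarrow> 'a \<Rightarrow> real" where
  "phi_rot t e a b c = cos t * phi a b c - sin t * psi e a b c + (1 - cos t) * phi_wedge e e a b c"

definition psi_rot :: "real \<Rightarrow> 'a \<Rightarrow> 'a \<Rightarrow> 'a \<Rightarrow> 'a \<Rightarrow> 'a \<Rightarrow> real" where
  "psi_rot t e p q r s = psi p q r s - (1 - cos t) * wedge1 e (psi e) p q r s
     + sin t * wedge1 e phi p q r s"

lemma phi_self: "phi a a b = 0" "phi a b a = 0" "phi a b b = 0"
  by (simp_all add: cr_self cr_orthogonal)

lemma psi_self: "psi a a b c = 0"
  using psi_swap(1)[of a a b c] by simp

lemma psi_cr_wedge: "psi (x \<odot> y) a b c = phi_wedge y x a b c - phi_wedge x y a b c"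
  unfolding psi_cr phi_wedge_def by simp

text \<open>
  The derivation of the exterior algebra that extends \<open>e \<times> \<cdot>\<close> maps \<open>\<phi>\<close> to a multiple of \<open>e \<lrcorner> \<psi>\<close> and
  \<open>\<psi>\<close> to a multiple of \<open>e \<and> \<phi>\<close>. These two facts replace a direct computation of \<open>\<star>(e \<lrcorner> \<psi>)\<close>.
\<close>

lemma cr_derivation_phi:
  "phi (e \<odot> a) b c + phi a (e \<odot> b) c + phi a b (e \<odot> c) = - 3 * psi e a b c"
proof -
  have *: "phi (e \<odot> a) b c = (e \<bullet> b) * (a \<bullet> c) - (e \<bullet> c) * (a \<bullet> b) - psi e a b c" for a b c
    unfolding cross_psi_def using cyclic[of "e \<odot> a" b c] by (simp add: inner_commute)
  have "psi e b c a = psi e a b c" "psi e c a b = psi e a b c"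
    using psi_swap(2)[of e a b c] psi_swap(3)[of e b a c] psi_swap(2)[of e c a b] psi_swap(3)[of e a c b] by simp_all
  moreover have "phi a (e \<odot> b) c = phi (e \<odot> b) c a" "phi a b (e \<odot> c) = phi (e \<odot> c) a b"
    by (rule phi_perm)+
  ultimately show ?thesis
    unfolding * by (simp add: inner_commute)
qed

lemma cr_derivation_psi:
  "psi (e \<odot> a) b c d + psi a (e \<odot> b) c d + psi a b (e \<odot> c) d + psi a b c (e \<odot> d)
    = 3 * wedge1 e phi a b c d"
proof -
  have 1: "psi a (e \<odot> b) c d = - psi (e \<odot> b) a c d"
    by (rule psi_swap)
  have 2: "psi a b (e \<odot> c) d = psi (e \<odot> c) a b d"
    using psi_swap(2)[of a b "e \<odot> c" d] psi_swap(1)[of a "e \<odot> c" b d] by simp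
  have 3: "psi a b c (e \<odot> d) = - psi (e \<odot> d) a b c"
    using psi_swap(3)[of a b c "e \<odot> d"] psi_swap(2)[of a b "e \<odot> d" c] psi_swap(1)[of a "e \<odot> d" b c] by simp
  have P: "phi_wedge x y a b c = (x \<bullet> a) * phi y b c - (x \<bullet> b) * phi y a c + (x \<bullet> c) * phi y a b" for x y a b c
    unfolding phi_wedge_def using phi_perm(4)[of y c a] by simp
  have i: "b \<bullet> a = a \<bullet> b" "c \<bullet> a = a \<bullet> c" "d \<bullet> a = a \<bullet> d" "c \<bullet> b = b \<bullet> c" "d \<bullet> b = b \<bullet> d" "d \<bullet> c = c \<bullet> d"
    by (simp_all add: inner_commute)
  have j: "phi b a c = - phi a b c" "phi b a d = - phi a b d" "phi c a b = phi a b c" "phi c a d = - phi a c d"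
    "phi c b d = - phi b c d" "phi d a b = phi a b d" "phi d a c = phi a c d" "phi d b c = phi b c d"
    by (rule phi_perm)+
  show ?thesis
    unfolding 1 2 3 psi_cr_wedge P wedge1_def i j by (simp add: algebra_simps)
qed

text \<open>
  The left-hand side is the derivative of \<open>phi_rot t e\<close> in \<open>t\<close>.
\<close>

lemma phi_rot_angle_variation:
  assumes e: "e \<bullet> e = 1"
  shows "- sin t * phi a b c - cos t * psi e a b c + sin t * phi_wedge e e a b c = - psi_rot t e e a b c"
  by (simp add: psi_rot_def wedge1_def psi_self phi_wedge_def e phi_perm(1)[of a e] phi_perm(2)[of b e]
       phi_perm(3)[of a b e] phi_perm(3)[of a c e] phi_perm(1)[of c a] phi_perm(4)[of e c a] algebra_simps)

text \<open>
  The left-hand side is the derivative of \<open>phi_rot t e\<close> when \<open>e\<close> moves on the unit sphere with velocity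
  \<open>w\<close>. With \<open>m = e \<times> w\<close> one has \<open>e \<times> m = - w\<close>, so contraction of \<open>e \<and> (e \<lrcorner> \<psi>)\<close> with \<open>w\<close> and \<open>m\<close>
  yields \<open>e \<and> (m \<lrcorner> \<phi>)\<close> and \<open>- e \<and> (w \<lrcorner> \<phi>)\<close>, and \<open>m \<lrcorner> \<psi>\<close> is given by the contraction identity;
  the coefficients then agree because \<open>sin\<^sup>2 t + (1 - cos t)\<^sup>2 = 2 (1 - cos t)\<close>.
\<close>

lemma phi_rot_axis_variation:
  assumes e: "e \<bullet> e = 1" and w: "e \<bullet> w = 0"
  shows "- sin t * psi w a b c + (1 - cos t) * (phi_wedge w e a b c + phi_wedge e w a b c)
    = psi_rot t e (- sin t *\<^sub>R w + (1 - cos t) *\<^sub>R (e \<odot> w)) a b c"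
proof -
  define m where "m = e \<odot> w"
  have em: "e \<bullet> m = 0"
    unfolding m_def using cr_orthogonal[of e w] by (simp add: inner_commute)
  have e_m: "e \<odot> m = - w"
    unfolding m_def cr_cr by (simp add: e w)
  have psi_ew: "psi e w p q = (e \<bullet> p) * (w \<bullet> q) - (e \<bullet> q) * (w \<bullet> p) - phi p q m" for p q
    unfolding cross_psi_def m_def by (simp add: inner_commute)
  have psi_em: "psi e m p q = (e \<bullet> p) * (m \<bullet> q) - (e \<bullet> q) * (m \<bullet> p) + phi p q w" for p q
    unfolding cross_psi_def e_m by (simp add: inner_commute)
  have psi_m: "psi m a b c = phi_wedge w e a b c - phi_wedge e w a b c"
    unfolding m_def by (rule psi_cr_wedge)
  have w1: "wedge1 e \<beta> w a b c = - (e \<bullet> a) * \<beta> w b c + (e \<bullet> b) * \<beta> w a c - (e \<bullet> c) * \<beta> w a b" for \<beta>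
    by (simp add: wedge1_def w)
  have m1: "wedge1 e \<beta> m a b c = - (e \<bullet> a) * \<beta> m b c + (e \<bullet> b) * \<beta> m a c - (e \<bullet> c) * \<beta> m a b" for \<beta>
    by (simp add: wedge1_def em)
  have P: "phi_wedge e v a b c = (e \<bullet> a) * phi v b c - (e \<bullet> b) * phi v a c + (e \<bullet> c) * phi v a b" for v
    unfolding phi_wedge_def by (simp add: phi_perm(1)[of a v] phi_perm(2)[of v c a] phi_perm(1)[of c a v] phi_perm(3)[of a c v])
  have psi_w1: "wedge1 e (psi e) w a b c = phi_wedge e m a b c"
    unfolding w1 P psi_ew phi_perm(3)[of _ _ m] by (simp add: algebra_simps)
  have psi_m1: "wedge1 e (psi e) m a b c = - phi_wedge e w a b c"
    unfolding m1 P psi_em phi_perm(3)[of _ _ w] by (simp add: algebra_simps)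
  have phi_1: "wedge1 e phi w a b c = - phi_wedge e w a b c" "wedge1 e phi m a b c = - phi_wedge e m a b c"
    unfolding w1 m1 P by (simp_all add: algebra_simps)
  have lin: "wedge1 e \<beta> (x *\<^sub>R w + y *\<^sub>R m) a b c = x * wedge1 e \<beta> w a b c + y * wedge1 e \<beta> m a b c"
    if "\<And>p q. \<beta> (x *\<^sub>R w + y *\<^sub>R m) p q = x * \<beta> w p q + y * \<beta> m p q" for x y \<beta>
    unfolding wedge1_def that by (simp add: inner_add_right algebra_simps)
  have psi_lin: "psi e (x *\<^sub>R w + y *\<^sub>R m) p q = x * psi e w p q + y * psi e m p q" for x y p q
    using psi_swap(1)[of e _ p q] by (simp add: psi_linear1)
  have "psi_rot t e (x *\<^sub>R w + y *\<^sub>R m) a b c = x * psi w a b c + y * psi m a b c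
     - (1 - cos t) * (x * phi_wedge e m a b c - y * phi_wedge e w a b c)
     - sin t * (x * phi_wedge e w a b c + y * phi_wedge e m a b c)" for x y
    unfolding psi_rot_def lin[OF psi_lin] psi_w1 psi_m1
    by (subst lin) (simp_all add: phi_1 psi_linear1 cr_linear inner_add_left algebra_simps)
  note rot = this[of "- sin t" "1 - cos t"]
  have "cos t * cos t + sin t * sin t = 1"
    using sin_cos_squared_add2[of t] by (simp add: power2_eq_square)
  then show ?thesis
    unfolding m_def[symmetric] rot psi_m by algebra
qed

text \<open>
  Contracting with \<open>e\<close> leaves a three-form \<open>Omega\<close> on \<open>e\<^sup>\<bottom>\<close>, which is \<open>\<phi>\<close> with its first argument
  turned by a rotation of \<open>e\<^sup>\<bottom>\<close>. It is nondegenerate: if it kills \<open>q\<close>, let \<open>n\<close> be the turned \<open>q\<close> and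
  \<open>y\<close> orthogonal to \<open>e\<close>, \<open>n\<close> and \<open>e \<times> n\<close>; then \<open>n \<times> y\<close> lies in \<open>e\<^sup>\<bottom>\<close>, so \<open>|n \<times> y|\<^sup>2 = |n|\<^sup>2|y|\<^sup>2\<close>
  vanishes. This excludes the component of \<open>T\<close> in \<open>e\<^sup>\<bottom>\<close>, and then, since \<open>e \<lrcorner> \<psi>'\<close> restricts to
  \<open>Omega\<close> on \<open>e\<^sup>\<bottom>\<close>, also a nonzero multiple of \<open>e\<close>.
\<close>

lemma psi_rot_injective:
  fixes T :: 'a
  assumes e: "e \<bullet> e = 1"
    and dim: "\<And>x y z :: 'a. \<exists>v. v \<noteq> 0 \<and> v \<bullet> x = 0 \<and> v \<bullet> y = 0 \<and> v \<bullet> z = 0"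
    and T: "\<And>a b c. psi_rot t e T a b c = 0"
  shows "T = 0"
proof -
  define Omega where "Omega q r s = cos t * psi e q r s + sin t * phi q r s" for q r s
  have Omega_inj: "q = 0" if q: "e \<bullet> q = 0" and 0: "\<And>r s. e \<bullet> r = 0 \<Longrightarrow> e \<bullet> s = 0 \<Longrightarrow> Omega q r s = 0" for q
  proof -
    define n where "n = sin t *\<^sub>R q - cos t *\<^sub>R (e \<odot> q)"
    have en: "e \<bullet> n = 0"
      by (simp add: n_def inner_diff_right q cr_orthogonal inner_commute[of e "_ \<odot> _"])
    have Omega: "Omega q r s = phi n r s" if "e \<bullet> r = 0" "e \<bullet> s = 0" for r s
    proof -
      have "psi e q r s = - phi r s (e \<odot> q)"
        by (simp add: cross_psi_def that inner_commute)
      then show ?thesis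
        by (simp add: Omega_def n_def cr_linear inner_diff_left phi_perm(3)[of r s])
    qed
    obtain y where y: "y \<noteq> 0" "y \<bullet> e = 0" "y \<bullet> n = 0" "y \<bullet> (e \<odot> n) = 0"
      using dim by blast
    have "e \<bullet> (n \<odot> y) = 0"
      using y(4) cyclic[of e n y] by (simp add: inner_commute)
    then have "phi n y (n \<odot> y) = 0"
      using 0[of y "n \<odot> y"] Omega[of y "n \<odot> y"] y(2) by (simp add: inner_commute)
    then have "(n \<bullet> n) * (y \<bullet> y) = 0"
      unfolding lagrange using y(3) by (simp add: inner_commute)
    with y(1) have "n = 0"
      by simp
    moreover have "n \<bullet> n = q \<bullet> q"
    proof -
      have "(e \<odot> q) \<bullet> (e \<odot> q) = q \<bullet> q"
        unfolding lagrange by (simp add: e q)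
      then have "n \<bullet> n = sin t * (sin t * (q \<bullet> q)) + cos t * (cos t * (q \<bullet> q))"
        unfolding n_def
        by (simp add: inner_diff_left inner_diff_right cr_orthogonal inner_commute[of q "_ \<odot> _"] algebra_simps)
      also have "\<dots> = ((sin t)\<^sup>2 + (cos t)\<^sup>2) * (q \<bullet> q)"
        by (simp only: power2_eq_square algebra_simps)
      finally show ?thesis
        by simp
    qed
    ultimately show ?thesis
      by simp
  qed
  define \<alpha> where "\<alpha> = e \<bullet> T"
  define q where "q = T - \<alpha> *\<^sub>R e"
  have eq: "e \<bullet> q = 0" and T_eq: "T = q + \<alpha> *\<^sub>R e"
    by (simp_all add: q_def \<alpha>_def inner_diff_right e)
  have "q = 0"
  proof (rule Omega_inj[OF eq])
    fix r s assume rs: "e \<bullet> r = 0" "e \<bullet> s = 0"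
    have "psi e T r s = psi e q r s"
      using psi_swap(1)[of e "q + \<alpha> *\<^sub>R e" r s] psi_swap(1)[of e q r s] psi_self[of e r s]
      unfolding T_eq psi_linear1 by simp
    then have "psi_rot t e T e r s = - Omega q r s"
      using psi_swap(1)[of q e r s] psi_self[of e r s]
      by (simp add: psi_rot_def wedge1_def rs Omega_def T_eq e eq psi_linear1 cr_linear inner_add_left inner_add_right algebra_simps)
    with T show "Omega q r s = 0"
      by simp
  qed
  then have T_eq: "T = \<alpha> *\<^sub>R e"
    by (simp add: T_eq)
  obtain v where v: "v \<noteq> 0" "v \<bullet> e = 0"
    using dim by blast
  have "\<alpha> = 0"
  proof (rule ccontr)
    assume "\<alpha> \<noteq> 0"
    have "v = 0"
    proof (rule Omega_inj)
      show "e \<bullet> v = 0"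
        using v by (simp add: inner_commute)
      fix r s assume rs: "e \<bullet> r = 0" "e \<bullet> s = 0"
      have "psi_rot t e (\<alpha> *\<^sub>R e) v r s = \<alpha> * Omega v r s"
        using v(2) by (simp add: psi_rot_def wedge1_def rs Omega_def e psi_linear1 inner_commute[of e v] algebra_simps)
      with T \<open>\<alpha> \<noteq> 0\<close> show "Omega v r s = 0"
        by (simp add: T_eq)
    qed
    with v show False
      by simp
  qed
  with T_eq show ?thesis
    by simp
qed

end

section \<open>The cross product on seven-dimensional space\<close>

lemma exhaust_7:
  fixes x :: 7
  shows "x = 1 \<or> x = 2 \<or> x = 3 \<or> x = 4 \<or> x = 5 \<or> x = 6 \<or> x = 7"
proof (induct x)
  case (of_int z)
  then have "z = 0 \<or> z = 1 \<or> z = 2 \<or> z = 3 \<or> z = 4 \<or> z = 5 \<or> z = 6"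
    by fastforce
  then show ?case
    by auto
qed

lemma forall_7: "(\<forall>i::7. P i) \<longleftrightarrow> P 1 \<and> P 2 \<and> P 3 \<and> P 4 \<and> P 5 \<and> P 6 \<and> P 7"
  by (metis exhaust_7)

lemma UNIV_7: "UNIV = {1::7, 2, 3, 4, 5, 6, 7}"
  using exhaust_7 by auto

lemma sum_7: "(\<Sum>i\<in>(UNIV::7 set). f i) = f 1 + f 2 + f 3 + f 4 + f 5 + f 6 + (f 7 :: 'a::comm_monoid_add)"
  unfolding UNIV_7 by (simp add: add.assoc)

lemma vector_7:
  "(vector [a,b,c,d,e,f,g] :: 'a::zero^7) $ 1 = a"
  "(vector [a,b,c,d,e,f,g] :: 'a::zero^7) $ 2 = b"
  "(vector [a,b,c,d,e,f,g] :: 'a::zero^7) $ 3 = c"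
  "(vector [a,b,c,d,e,f,g] :: 'a::zero^7) $ 4 = d"
  "(vector [a,b,c,d,e,f,g] :: 'a::zero^7) $ 5 = e"
  "(vector [a,b,c,d,e,f,g] :: 'a::zero^7) $ 6 = f"
  "(vector [a,b,c,d,e,f,g] :: 'a::zero^7) $ 7 = g"
  unfolding vector_def by simp_all

definition cross7 :: "real^7 \<Rightarrow> real^7 \<Rightarrow> real^7" where
  "cross7 a b = (\<chi> k. \<Sum>i\<in>UNIV. \<Sum>j\<in>UNIV. a $ i * b $ j * phi_std i j k)"

lemma cross7_components:
  "cross7 a b $ 1 = a $ 2 * b $ 3 - a $ 3 * b $ 2 + a $ 4 * b $ 5 - a $ 5 * b $ 4 - a $ 6 * b $ 7 + a $ 7 * b $ 6"
  "cross7 a b $ 2 = - a $ 1 * b $ 3 + a $ 3 * b $ 1 + a $ 4 * b $ 6 + a $ 5 * b $ 7 - a $ 6 * b $ 4 - a $ 7 * b $ 5"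
  "cross7 a b $ 3 = a $ 1 * b $ 2 - a $ 2 * b $ 1 + a $ 4 * b $ 7 - a $ 5 * b $ 6 + a $ 6 * b $ 5 - a $ 7 * b $ 4"
  "cross7 a b $ 4 = - a $ 1 * b $ 5 - a $ 2 * b $ 6 - a $ 3 * b $ 7 + a $ 5 * b $ 1 + a $ 6 * b $ 2 + a $ 7 * b $ 3"
  "cross7 a b $ 5 = a $ 1 * b $ 4 - a $ 2 * b $ 7 + a $ 3 * b $ 6 - a $ 4 * b $ 1 - a $ 6 * b $ 3 + a $ 7 * b $ 2"
  "cross7 a b $ 6 = a $ 1 * b $ 7 + a $ 2 * b $ 4 - a $ 3 * b $ 5 - a $ 4 * b $ 2 + a $ 5 * b $ 3 - a $ 7 * b $ 1"
  "cross7 a b $ 7 = - a $ 1 * b $ 6 + a $ 2 * b $ 5 + a $ 3 * b $ 4 - a $ 4 * b $ 3 - a $ 5 * b $ 2 + a $ 6 * b $ 1"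
  by (simp_all add: cross7_def phi_std_def sum_7 dx3_def wedge12_def wedge11_def dx_def)

lemma cross7_lagrange:
  "cross7 a b \<bullet> cross7 a c = (a \<bullet> a) * (b \<bullet> c) - (a \<bullet> b) * (a \<bullet> c)"
  by (simp add: inner_vec_def sum_7 cross7_components) algebra

lemma cross7_skew: "cross7 a b = - cross7 b a"
  by (simp add: vec_eq_iff forall_7 cross7_components)

lemma cross7_cyc: "cross7 a b \<bullet> c = cross7 b c \<bullet> a"
  by (simp add: inner_vec_def sum_7 cross7_components) algebra

interpretation cross7: vector_cross_product cross7
proof
  show "bilinear cross7"
    unfolding bilinear_def
    by (auto intro!: linearI simp: vec_eq_iff forall_7 cross7_components algebra_simps)
qed (rule cross7_skew cross7_cyc cross7_lagrange)+

text \<open>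
  In this form the volume form depends on the map from positions to indices, which makes permutations
  and replacements of rows accessible.
\<close>

lemma vol7_eq:
  "vol7 a b c i j k l = det (\<chi> n. axis ((vector [a,b,c,i,j,k,l] :: 7^7) $ n) 1 :: real^7^7)"
  unfolding vol7_def by (rule arg_cong[where f=det]) (simp add: vec_eq_iff[where 'b=7] forall_7 vector_7)

lemma det_axis_swap:
  fixes f :: "'n::finite \<Rightarrow> 'n"
  assumes "m \<noteq> n"
  shows "det (\<chi> i. axis (f (Transposition.transpose m n i)) 1 :: real^'n^'n) = - det (\<chi> i. axis (f i) 1 :: real^'n^'n)"
  using det_permute_rows[of "Transposition.transpose m n" "\<chi> i. axis (f i) 1 :: real^'n^'n"] assms
  by (simp add: permutes_swap_id sign_swap_id)

lemma vol7_swap: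
  "vol7 a b c d e f g = - vol7 b a c d e f g"
  "vol7 a b c d e f g = - vol7 a c b d e f g"
  "vol7 a b c d e f g = - vol7 a b d c e f g"
  "vol7 a b c d e f g = - vol7 a b c e d f g"
  "vol7 a b c d e f g = - vol7 a b c d f e g"
  "vol7 a b c d e f g = - vol7 a b c d e g f"
proof -
  have swap: "det (\<chi> n. axis (v $ n) 1 :: real^7^7) = - det (\<chi> n. axis (w $ n) 1 :: real^7^7)"
    if "m \<noteq> n" "\<forall>i. v $ i = w $ Transposition.transpose m n i" for v w :: "7^7" and m n
    using det_axis_swap[OF that(1), of "\<lambda>i. w $ i"] that(2) by simp
  show "vol7 a b c d e f g = - vol7 b a c d e f g"
    unfolding vol7_eq by (rule swap[of 1 2]) (simp_all add: forall_7 vector_7 Transposition.transpose_def)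
  show "vol7 a b c d e f g = - vol7 a c b d e f g"
    unfolding vol7_eq by (rule swap[of 2 3]) (simp_all add: forall_7 vector_7 Transposition.transpose_def)
  show "vol7 a b c d e f g = - vol7 a b d c e f g"
    unfolding vol7_eq by (rule swap[of 3 4]) (simp_all add: forall_7 vector_7 Transposition.transpose_def)
  show "vol7 a b c d e f g = - vol7 a b c e d f g"
    unfolding vol7_eq by (rule swap[of 4 5]) (simp_all add: forall_7 vector_7 Transposition.transpose_def)
  show "vol7 a b c d e f g = - vol7 a b c d f e g"
    unfolding vol7_eq by (rule swap[of 5 6]) (simp_all add: forall_7 vector_7 Transposition.transpose_def)
  show "vol7 a b c d e f g = - vol7 a b c d e g f"
    unfolding vol7_eq by (rule swap[of 6 7]) (simp_all add: forall_7 vector_7 Transposition.transpose_def)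
qed

lemma vol7_repeat:
  "vol7 a a c d e f g = 0"
  "vol7 a b b d e f g = 0"
  "vol7 a b c c e f g = 0"
  "vol7 a b c d d f g = 0"
  "vol7 a b c d e e g = 0"
  "vol7 a b c d e f f = 0"
  using vol7_swap[of a a c d e f g] vol7_swap[of a b b d e f g] vol7_swap[of a b c c e f g]
    vol7_swap[of a b c d d f g] vol7_swap[of a b c d e e g] vol7_swap[of a b c d e f f]
  by linarith+

lemma vol7_standard: "vol7 1 2 3 4 5 6 7 = 1"
proof -
  have "(\<chi> n. axis ((vector [1,2,3,4,5,6,7] :: 7^7) $ n) 1 :: real^7^7) = mat 1"
    unfolding vec_eq_iff[where 'b=7] forall_7 by (simp add: vector_7 mat_def axis_def)
  then show ?thesis
    unfolding vol7_eq by simp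
qed

section \<open>The Hodge dual of the standard form\<close>

text \<open>
  The order \<open>1 < \<dots> < 7\<close> of the indices; in the order of the index type \<open>7 = 0\<close> is the least element.
\<close>

definition rank7 :: "7 \<Rightarrow> nat" where
  "rank7 i = (if i = 1 then 1 else if i = 2 then 2 else if i = 3 then 3 else if i = 4 then 4
     else if i = 5 then 5 else if i = 6 then 6 else 7)"

text \<open>
  As rewrite rules these sort the indices of a concrete instance of the volume form.
\<close>

lemma vol7_sort:
  "rank7 b < rank7 a \<Longrightarrow> vol7 a b c d e f g = - vol7 b a c d e f g"
  "rank7 c < rank7 b \<Longrightarrow> vol7 a b c d e f g = - vol7 a c b d e f g"
  "rank7 d < rank7 c \<Longrightarrow> vol7 a b c d e f g = - vol7 a b d c e f g"
  "rank7 e < rank7 d \<Longrightarrow> vol7 a b c d e f g = - vol7 a b c e d f g"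
  "rank7 f < rank7 e \<Longrightarrow> vol7 a b c d e f g = - vol7 a b c d f e g"
  "rank7 g < rank7 f \<Longrightarrow> vol7 a b c d e f g = - vol7 a b c d e g f"
  by (rule vol7_swap)+

lemma sum3_dx:
  "(\<Sum>p\<in>UNIV. \<Sum>q\<in>UNIV. \<Sum>r\<in>UNIV. dx c r * (dx b q * (dx a p * V p q r))) = V a b c"
  by (simp add: dx_def mult_delta_left)

lemma hodge3_dx3: "hodge3 (dx3 a b c) i j k l = vol7 a b c i j k l"
proof -
  define V where "V a b c = vol7 a b c i j k l" for a b c
  have V: "V a b c = - V b a c" "V a b c = - V a c b" for a b c
    unfolding V_def by (rule vol7_swap)+
  have e: "V p q r * dx3 a b c p q r =
     dx c r * (dx b q * (dx a p * V p q r)) - dx b r * (dx c q * (dx a p * V p q r))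
     + dx b r * (dx a q * (dx c p * V p q r)) - dx c r * (dx a q * (dx b p * V p q r))
     + dx a r * (dx c q * (dx b p * V p q r)) - dx a r * (dx b q * (dx c p * V p q r))" for p q r
     unfolding dx3_def wedge12_def wedge11_def by (simp add: algebra_simps)
  have "(\<Sum>p\<in>UNIV. \<Sum>q\<in>UNIV. \<Sum>r\<in>UNIV. V p q r * dx3 a b c p q r)
    = V a b c - V a c b + V c a b - V b a c + V b c a - V c b a"
    unfolding e sum.distrib sum_subtractf sum3_dx ..
  also have "\<dots> = 6 * V a b c"
    using V(1)[of a b c] V(2)[of a b c] V(1)[of c a b] V(2)[of b a c] V(1)[of b c a] by linarith
  finally show ?thesis
    by (simp add: hodge3_def V_def)
qed

lemma hodge3_diff:
  "hodge3 (\<lambda>i j k. \<alpha> i j k - \<beta> i j k) i j k l = hodge3 \<alpha> i j k l - hodge3 \<beta> i j k l"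
  by (simp add: hodge3_def right_diff_distrib sum_subtractf diff_divide_distrib)

lemma hodge3_phi_std: "hodge3 phi_std i j k l =
    vol7 1 2 3 i j k l - vol7 1 6 7 i j k l - vol7 5 2 7 i j k l - vol7 5 6 3 i j k l
    - vol7 4 1 5 i j k l - vol7 4 2 6 i j k l - vol7 4 3 7 i j k l"
  unfolding phi_std_def[abs_def] hodge3_diff hodge3_dx3 ..

lemma rank7_simps: "rank7 1 = 1" "rank7 2 = 2" "rank7 3 = 3" "rank7 4 = 4" "rank7 5 = 5" "rank7 6 = 6" "rank7 7 = 7"
  by (simp_all add: rank7_def)

text \<open>
  Insertion sort: the facts \<open>4\<close> and \<open>3\<close> and the final case distinction place the fourth, the third and
  the second index.
\<close>

lemma alternating_eq_0:
  fixes D :: "7 \<Rightarrow> 7 \<Rightarrow> 7 \<Rightarrow> 7 \<Rightarrow> real"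
  assumes swap: "\<And>i j k l. D i j k l = - D j i k l" "\<And>i j k l. D i j k l = - D i k j l"
      "\<And>i j k l. D i j k l = - D i j l k"
    and sorted: "\<And>i j k l. rank7 i < rank7 j \<Longrightarrow> rank7 j < rank7 k \<Longrightarrow> rank7 k < rank7 l \<Longrightarrow> D i j k l = 0"
  shows "D i j k l = 0"
proof -
  have inj: "rank7 i = rank7 j \<Longrightarrow> i = j" for i j
    using exhaust_7[of i] exhaust_7[of j] by (auto simp: rank7_simps)
  have rep: "D i i k l = 0" "D i j j l = 0" "D i j k k = 0" for i j k l
    using swap(1)[of i i k l] swap(2)[of i j j l] swap(3)[of i j k k] by simp_all
  have 4: "D i j k l = 0" if "rank7 i < rank7 j" "rank7 j < rank7 k" for i j k l
  proof -
    consider "rank7 k < rank7 l" | "k = l" | "rank7 l < rank7 k" "rank7 j < rank7 l" | "j = l"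
      | "rank7 l < rank7 j" "rank7 i < rank7 l" | "i = l" | "rank7 l < rank7 i"
      using inj that by (metis linorder_neqE_nat)
    then show ?thesis
    proof cases
      case 1 with that show ?thesis by (simp add: sorted)
    next
      case 2 then show ?thesis by (simp add: rep)
    next
      case 3 then show ?thesis using swap(3)[of i j k l] sorted[of i j l k] that by simp
    next
      case 4 then show ?thesis using swap(3)[of i j k j] by (simp add: rep)
    next
      case 5 then show ?thesis using swap(3)[of i j k l] swap(2)[of i j l k] sorted[of i l j k] that by simp
    next
      case 6 then show ?thesis using swap(3)[of i j k i] swap(2)[of i j i k] by (simp add: rep)
    next
      case 7 then show ?thesis
        using swap(3)[of i j k l] swap(2)[of i j l k] swap(1)[of i l j k] sorted[of l i j k] that by simp
    qed
  qed
  have 3: "D i j k l = 0" if "rank7 i < rank7 j" for i j k l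
  proof -
    consider "rank7 j < rank7 k" | "j = k" | "rank7 k < rank7 j" "rank7 i < rank7 k" | "i = k" | "rank7 k < rank7 i"
      using inj that by (metis linorder_neqE_nat)
    then show ?thesis
    proof cases
      case 1 with that show ?thesis using 4[of i j k l] by simp
    next
      case 2 then show ?thesis by (simp add: rep)
    next
      case 3 then show ?thesis using swap(2)[of i j k l] 4[of i k j l] by simp
    next
      case 4 then show ?thesis using swap(2)[of i j i l] by (simp add: rep)
    next
      case 5 then show ?thesis using swap(2)[of i j k l] swap(1)[of i k j l] 4[of k i j l] that by simp
    qed
  qed
  consider "rank7 i < rank7 j" | "i = j" | "rank7 j < rank7 i"
    using inj by (metis linorder_neqE_nat)
  then show ?thesis
    using 3 rep swap(1)[of i j k l] by cases simp_all
qed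

text \<open>
  The \<open>35\<close> independent components of \<open>\<star>\<phi>\<close>. For each of them at most one of the seven terms of
  \<open>hodge3_phi_std\<close> is nonzero.
\<close>

lemma hodge3_phi_std_sorted:
  "hodge3 phi_std 1 2 3 4 = cross_psi cross7 (axis 1 1) (axis 2 1) (axis 3 1) (axis 4 1)"
  "hodge3 phi_std 1 2 3 5 = cross_psi cross7 (axis 1 1) (axis 2 1) (axis 3 1) (axis 5 1)"
  "hodge3 phi_std 1 2 3 6 = cross_psi cross7 (axis 1 1) (axis 2 1) (axis 3 1) (axis 6 1)"
  "hodge3 phi_std 1 2 3 7 = cross_psi cross7 (axis 1 1) (axis 2 1) (axis 3 1) (axis 7 1)"
  "hodge3 phi_std 1 2 4 5 = cross_psi cross7 (axis 1 1) (axis 2 1) (axis 4 1) (axis 5 1)"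
  "hodge3 phi_std 1 2 4 6 = cross_psi cross7 (axis 1 1) (axis 2 1) (axis 4 1) (axis 6 1)"
  "hodge3 phi_std 1 2 4 7 = cross_psi cross7 (axis 1 1) (axis 2 1) (axis 4 1) (axis 7 1)"
  "hodge3 phi_std 1 2 5 6 = cross_psi cross7 (axis 1 1) (axis 2 1) (axis 5 1) (axis 6 1)"
  "hodge3 phi_std 1 2 5 7 = cross_psi cross7 (axis 1 1) (axis 2 1) (axis 5 1) (axis 7 1)"
  "hodge3 phi_std 1 2 6 7 = cross_psi cross7 (axis 1 1) (axis 2 1) (axis 6 1) (axis 7 1)"
  "hodge3 phi_std 1 3 4 5 = cross_psi cross7 (axis 1 1) (axis 3 1) (axis 4 1) (axis 5 1)"
  "hodge3 phi_std 1 3 4 6 = cross_psi cross7 (axis 1 1) (axis 3 1) (axis 4 1) (axis 6 1)"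
  "hodge3 phi_std 1 3 4 7 = cross_psi cross7 (axis 1 1) (axis 3 1) (axis 4 1) (axis 7 1)"
  "hodge3 phi_std 1 3 5 6 = cross_psi cross7 (axis 1 1) (axis 3 1) (axis 5 1) (axis 6 1)"
  "hodge3 phi_std 1 3 5 7 = cross_psi cross7 (axis 1 1) (axis 3 1) (axis 5 1) (axis 7 1)"
  "hodge3 phi_std 1 3 6 7 = cross_psi cross7 (axis 1 1) (axis 3 1) (axis 6 1) (axis 7 1)"
  "hodge3 phi_std 1 4 5 6 = cross_psi cross7 (axis 1 1) (axis 4 1) (axis 5 1) (axis 6 1)"
  "hodge3 phi_std 1 4 5 7 = cross_psi cross7 (axis 1 1) (axis 4 1) (axis 5 1) (axis 7 1)"
  "hodge3 phi_std 1 4 6 7 = cross_psi cross7 (axis 1 1) (axis 4 1) (axis 6 1) (axis 7 1)"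
  "hodge3 phi_std 1 5 6 7 = cross_psi cross7 (axis 1 1) (axis 5 1) (axis 6 1) (axis 7 1)"
  "hodge3 phi_std 2 3 4 5 = cross_psi cross7 (axis 2 1) (axis 3 1) (axis 4 1) (axis 5 1)"
  "hodge3 phi_std 2 3 4 6 = cross_psi cross7 (axis 2 1) (axis 3 1) (axis 4 1) (axis 6 1)"
  "hodge3 phi_std 2 3 4 7 = cross_psi cross7 (axis 2 1) (axis 3 1) (axis 4 1) (axis 7 1)"
  "hodge3 phi_std 2 3 5 6 = cross_psi cross7 (axis 2 1) (axis 3 1) (axis 5 1) (axis 6 1)"
  "hodge3 phi_std 2 3 5 7 = cross_psi cross7 (axis 2 1) (axis 3 1) (axis 5 1) (axis 7 1)"
  "hodge3 phi_std 2 3 6 7 = cross_psi cross7 (axis 2 1) (axis 3 1) (axis 6 1) (axis 7 1)"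
  "hodge3 phi_std 2 4 5 6 = cross_psi cross7 (axis 2 1) (axis 4 1) (axis 5 1) (axis 6 1)"
  "hodge3 phi_std 2 4 5 7 = cross_psi cross7 (axis 2 1) (axis 4 1) (axis 5 1) (axis 7 1)"
  "hodge3 phi_std 2 4 6 7 = cross_psi cross7 (axis 2 1) (axis 4 1) (axis 6 1) (axis 7 1)"
  "hodge3 phi_std 2 5 6 7 = cross_psi cross7 (axis 2 1) (axis 5 1) (axis 6 1) (axis 7 1)"
  "hodge3 phi_std 3 4 5 6 = cross_psi cross7 (axis 3 1) (axis 4 1) (axis 5 1) (axis 6 1)"
  "hodge3 phi_std 3 4 5 7 = cross_psi cross7 (axis 3 1) (axis 4 1) (axis 5 1) (axis 7 1)"
  "hodge3 phi_std 3 4 6 7 = cross_psi cross7 (axis 3 1) (axis 4 1) (axis 6 1) (axis 7 1)"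
  "hodge3 phi_std 3 5 6 7 = cross_psi cross7 (axis 3 1) (axis 5 1) (axis 6 1) (axis 7 1)"
  "hodge3 phi_std 4 5 6 7 = cross_psi cross7 (axis 4 1) (axis 5 1) (axis 6 1) (axis 7 1)"
  by (simp_all add: hodge3_phi_std vol7_sort vol7_repeat vol7_standard rank7_simps
      cross_psi_def inner_vec_def sum_7 cross7_components axis_def)

lemma hodge3_swap:
  "hodge3 \<alpha> i j k l = - hodge3 \<alpha> j i k l"
  "hodge3 \<alpha> i j k l = - hodge3 \<alpha> i k j l"
  "hodge3 \<alpha> i j k l = - hodge3 \<alpha> i j l k"
  unfolding hodge3_def
  by (subst vol7_swap(4), simp add: sum_negf) (subst vol7_swap(5), simp add: sum_negf, subst vol7_swap(6), simp add: sum_negf)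

lemma hodge3_phi_std_eq:
  "hodge3 phi_std i j k l = cross_psi cross7 (axis i 1) (axis j 1) (axis k 1) (axis l 1)"
proof -
  define D where "D i j k l = hodge3 phi_std i j k l - cross_psi cross7 (axis i 1) (axis j 1) (axis k 1) (axis l 1)" for i j k l
  have "D i j k l = 0"
  proof (rule alternating_eq_0)
    fix i j k l
    show "D i j k l = - D j i k l"
      unfolding D_def by (subst hodge3_swap(1), subst cross7.psi_swap(1)) simp
    show "D i j k l = - D i k j l"
      unfolding D_def by (subst hodge3_swap(2), subst cross7.psi_swap(2)) simp
    show "D i j k l = - D i j l k"
      unfolding D_def by (subst hodge3_swap(3), subst cross7.psi_swap(3)) simp
    assume "rank7 i < rank7 j" "rank7 j < rank7 k" "rank7 k < rank7 l"
    then show "D i j k l = 0"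
      using exhaust_7[of i] exhaust_7[of j] exhaust_7[of k] exhaust_7[of l]
      by (elim disjE) (simp_all add: rank7_simps D_def hodge3_phi_std_sorted)
  qed
  then show ?thesis
    by (simp add: D_def)
qed

section \<open>The Hodge dual of the rotated form\<close>

text \<open>
  The trace formula for the derivative of the determinant under \<open>A\<close>, at a matrix whose rows are basis
  vectors. If the rows form a basis, replacing row \<open>n\<close> by its image multiplies the determinant by the
  diagonal entry of \<open>A\<close>, by Cramer's rule. If two rows coincide, replacing either of them gives opposite
  determinants, and replacing any other row gives zero.
\<close>

lemma det_axis_derivation:
  fixes a :: "'n::finite \<Rightarrow> 'n" and A :: "'n \<Rightarrow> 'n \<Rightarrow> real"
  shows "(\<Sum>n\<in>UNIV. \<Sum>m\<in>UNIV. A (a n) m * det (\<chi> i. axis ((a(n := m)) i) 1 :: real^'n^'n))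
    = (\<Sum>m\<in>UNIV. A m m) * det (\<chi> i. axis (a i) 1 :: real^'n^'n)"
proof -
  define r :: "'n \<Rightarrow> real^'n" where "r i = axis (a i) 1" for i
  define v :: "'n \<Rightarrow> real^'n" where "v n = (\<Sum>m\<in>UNIV. A (a n) m *s axis m 1)" for n
  have lin: "(\<Sum>m\<in>UNIV. A (a n) m * det (\<chi> i. axis ((a(n := m)) i) 1 :: real^'n^'n))
    = det (\<chi> i. if i = n then v n else r i)" for n
  proof -
    have "det (\<chi> i. if i = n then v n else r i) =
       (\<Sum>m\<in>UNIV. det (\<chi> i. if i = n then A (a n) m *s axis m 1 else r i))"
      unfolding v_def by (rule det_linear_row_sum) simp
    also have "\<dots> = (\<Sum>m\<in>UNIV. A (a n) m * det (\<chi> i. if i = n then axis m 1 else r i))"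
      unfolding det_row_mul ..
    also have "(\<lambda>m. (\<chi> i. if i = n then axis m 1 else r i)) = (\<lambda>m. (\<chi> i. axis ((a(n := m)) i) 1 :: real^'n^'n))"
      by (auto simp: r_def fun_eq_iff vec_eq_iff)
    finally show ?thesis
      by (simp add: fun_eq_iff)
  qed
  have "(\<Sum>n\<in>UNIV. det (\<chi> i. if i = n then v n else r i)) = (\<Sum>m\<in>UNIV. A m m) * det (\<chi> i. r i)"
  proof (cases "inj a")
    case True
    then have bij: "bij a"
      by (simp add: finite_UNIV_inj_surj bij_def)
    have "det (\<chi> i. if i = n then v n else r i) = A (a n) (a n) * det (\<chi> i. r i)" for n
    proof -
      have "v n = (\<Sum>i\<in>UNIV. A (a n) (a i) *s r i)"
        unfolding v_def r_def by (rule sum.reindex_bij_betw[OF bij, symmetric])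
      then show ?thesis
        using cramer_lemma_transpose[of n "\<chi> i. A (a n) (a i)" "\<chi> i. r i"]
        by (simp add: row_def cong: if_cong)
    qed
    then show ?thesis
      unfolding r_def
      by (simp add: sum_distrib_right[symmetric] sum.reindex_bij_betw[OF bij, of "\<lambda>m. A m m"])
  next
    case False
    then obtain p q where pq: "p \<noteq> q" "a p = a q"
      by (auto simp: inj_def)
    define M where "M n = (\<chi> i. if i = n then v n else r i)" for n
    have 0: "det (\<chi> i. r i) = 0"
      using pq by (intro det_identical_rows[of p q]) (simp_all add: row_def r_def)
    have other: "det (M n) = 0" if "n \<noteq> p" "n \<noteq> q" for n
      using pq that by (intro det_identical_rows[of p q]) (simp_all add: M_def row_def r_def)
    have "(\<chi> i. M p $ Transposition.transpose p q i) = M q"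
      using pq by (auto simp: vec_eq_iff M_def r_def v_def Transposition.transpose_def)
    then have "det (M q) = - det (M p)"
      using det_permute_rows[of "Transposition.transpose p q" "M p"] pq(1)
      by (simp add: permutes_swap_id sign_swap_id)
    then have "(\<Sum>n\<in>{p, q}. det (M n)) = 0"
      using pq(1) by simp
    moreover have "(\<Sum>n\<in>UNIV. det (M n)) = (\<Sum>n\<in>{p, q}. det (M n))"
      using other by (intro sum.mono_neutral_right) auto
    ultimately show ?thesis
      by (simp add: M_def 0)
  qed
  then show ?thesis
    unfolding lin r_def .
qed

lemma vol7_derivation:
  "(\<Sum>m\<in>UNIV. A a m * vol7 m b c i j k l + A b m * vol7 a m c i j k l + A c m * vol7 a b m i j k l
     + A i m * vol7 a b c m j k l + A j m * vol7 a b c i m k l + A k m * vol7 a b c i j m l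
     + A l m * vol7 a b c i j k m) = (\<Sum>m\<in>UNIV. A m m) * vol7 a b c i j k l"
proof -
  define f where "f n = (vector [a,b,c,i,j,k,l] :: 7^7) $ n" for n
  have f: "f 1 = a" "f 2 = b" "f 3 = c" "f 4 = i" "f 5 = j" "f 6 = k" "f 7 = l"
    unfolding f_def by (rule vector_7)+
  have upd: "det (\<chi> i. axis ((f(n := m)) i) 1 :: real^7^7) = det (\<chi> n. axis (v $ n) 1 :: real^7^7)"
    if "\<forall>i. (f(n := m)) i = v $ i" for n m v
    using that by simp
  have V: "vol7 m b c i j k l = det (\<chi> i. axis ((f(1 := m)) i) 1 :: real^7^7)"
    "vol7 a m c i j k l = det (\<chi> i. axis ((f(2 := m)) i) 1 :: real^7^7)"
    "vol7 a b m i j k l = det (\<chi> i. axis ((f(3 := m)) i) 1 :: real^7^7)"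
    "vol7 a b c m j k l = det (\<chi> i. axis ((f(4 := m)) i) 1 :: real^7^7)"
    "vol7 a b c i m k l = det (\<chi> i. axis ((f(5 := m)) i) 1 :: real^7^7)"
    "vol7 a b c i j m l = det (\<chi> i. axis ((f(6 := m)) i) 1 :: real^7^7)"
    "vol7 a b c i j k m = det (\<chi> i. axis ((f(7 := m)) i) 1 :: real^7^7)" for m
    unfolding vol7_eq by (rule upd[symmetric], simp add: forall_7 f vector_7)+
  have V0: "vol7 a b c i j k l = det (\<chi> i. axis (f i) 1 :: real^7^7)"
    unfolding vol7_eq f_def ..
  show ?thesis
    using det_axis_derivation[of A f]
    unfolding sum_7[of "\<lambda>n. \<Sum>m\<in>UNIV. A (f n) m * det (\<chi> i. axis ((f(n := m)) i) 1 :: real^7^7)"]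
      f V0[symmetric] V[symmetric] by (simp only: sum.distrib)
qed

text \<open>
  The action of a matrix \<open>A\<close> on forms as a derivation.
\<close>

definition derivation3 :: "(7 \<Rightarrow> 7 \<Rightarrow> real) \<Rightarrow> form3 \<Rightarrow> form3" where
  "derivation3 A \<alpha> i j k = (\<Sum>p\<in>UNIV. A i p * \<alpha> p j k + A j p * \<alpha> i p k + A k p * \<alpha> i j p)"

definition derivation4 :: "(7 \<Rightarrow> 7 \<Rightarrow> real) \<Rightarrow> form4 \<Rightarrow> form4" where
  "derivation4 A \<beta> i j k l =
    (\<Sum>p\<in>UNIV. A i p * \<beta> p j k l + A j p * \<beta> i p k l + A k p * \<beta> i j p l + A l p * \<beta> i j k p)"

text \<open>
  The infinitesimal form of the equivariance of the Hodge star under linear maps: transfer \<open>A\<close> from the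
  three-form to the first three slots of the volume form, and use the trace formula to move it to the
  other four.
\<close>

lemma hodge3_derivation:
  "hodge3 (derivation3 A \<alpha>) i j k l
    = (\<Sum>m\<in>UNIV. A m m) * hodge3 \<alpha> i j k l - derivation4 (\<lambda>p q. A q p) (hodge3 \<alpha>) i j k l"
proof -
  define V where "V a b c = vol7 a b c i j k l" for a b c
  define B where "B p q = A q p" for p q
  define W where "W a b c = (\<Sum>m\<in>UNIV. B i m * vol7 a b c m j k l + B j m * vol7 a b c i m k l
     + B k m * vol7 a b c i j m l + B l m * vol7 a b c i j k m)" for a b c
  have inner: "(\<Sum>m\<in>UNIV. B a m * V m b c + B b m * V a m c + B c m * V a b m)
      = (\<Sum>m\<in>UNIV. B m m) * V a b c - W a b c" for a b c
    using vol7_derivation[of B a b c i j k l] unfolding V_def W_def by (simp add: sum.distrib)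
  have 1: "(\<Sum>a\<in>UNIV. \<Sum>b\<in>UNIV. \<Sum>c\<in>UNIV. \<Sum>p\<in>UNIV. V a b c * (A a p * \<alpha> p b c))
      = (\<Sum>a\<in>UNIV. \<Sum>b\<in>UNIV. \<Sum>c\<in>UNIV. \<Sum>p\<in>UNIV. B a p * V p b c * \<alpha> a b c)"
    unfolding sum.cartesian_product
    by (rule sum.reindex_bij_witness[of _ "\<lambda>(a,b,c,p). (p,b,c,a)" "\<lambda>(a,b,c,p). (p,b,c,a)"])
      (auto simp: B_def)
  have 2: "(\<Sum>a\<in>UNIV. \<Sum>b\<in>UNIV. \<Sum>c\<in>UNIV. \<Sum>p\<in>UNIV. V a b c * (A b p * \<alpha> a p c))
      = (\<Sum>a\<in>UNIV. \<Sum>b\<in>UNIV. \<Sum>c\<in>UNIV. \<Sum>p\<in>UNIV. B b p * V a p c * \<alpha> a b c)"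
    unfolding sum.cartesian_product
    by (rule sum.reindex_bij_witness[of _ "\<lambda>(a,b,c,p). (a,p,c,b)" "\<lambda>(a,b,c,p). (a,p,c,b)"])
      (auto simp: B_def)
  have 3: "(\<Sum>a\<in>UNIV. \<Sum>b\<in>UNIV. \<Sum>c\<in>UNIV. \<Sum>p\<in>UNIV. V a b c * (A c p * \<alpha> a b p))
      = (\<Sum>a\<in>UNIV. \<Sum>b\<in>UNIV. \<Sum>c\<in>UNIV. \<Sum>p\<in>UNIV. B c p * V a b p * \<alpha> a b c)"
    unfolding sum.cartesian_product
    by (rule sum.reindex_bij_witness[of _ "\<lambda>(a,b,c,p). (a,b,p,c)" "\<lambda>(a,b,c,p). (a,b,p,c)"])
      (auto simp: B_def)
  have "(\<Sum>a\<in>UNIV. \<Sum>b\<in>UNIV. \<Sum>c\<in>UNIV. V a b c * derivation3 A \<alpha> a b c)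
    = (\<Sum>a\<in>UNIV. \<Sum>b\<in>UNIV. \<Sum>c\<in>UNIV. \<Sum>p\<in>UNIV. V a b c * (A a p * \<alpha> p b c))
    + (\<Sum>a\<in>UNIV. \<Sum>b\<in>UNIV. \<Sum>c\<in>UNIV. \<Sum>p\<in>UNIV. V a b c * (A b p * \<alpha> a p c))
    + (\<Sum>a\<in>UNIV. \<Sum>b\<in>UNIV. \<Sum>c\<in>UNIV. \<Sum>p\<in>UNIV. V a b c * (A c p * \<alpha> a b p))"
    unfolding derivation3_def sum_distrib_left distrib_left sum.distrib ..
  also have "\<dots> = (\<Sum>a\<in>UNIV. \<Sum>b\<in>UNIV. \<Sum>c\<in>UNIV.
      (\<Sum>m\<in>UNIV. B a m * V m b c + B b m * V a m c + B c m * V a b m) * \<alpha> a b c)"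
    unfolding 1 2 3 sum_distrib_right distrib_right sum.distrib ..
  also have "\<dots> = (\<Sum>m\<in>UNIV. B m m) * (\<Sum>a\<in>UNIV. \<Sum>b\<in>UNIV. \<Sum>c\<in>UNIV. V a b c * \<alpha> a b c)
      - (\<Sum>a\<in>UNIV. \<Sum>b\<in>UNIV. \<Sum>c\<in>UNIV. W a b c * \<alpha> a b c)"
    unfolding inner left_diff_distrib sum_subtractf by (simp add: sum_distrib_left mult.assoc)
  also have "(\<Sum>a\<in>UNIV. \<Sum>b\<in>UNIV. \<Sum>c\<in>UNIV. W a b c * \<alpha> a b c)
     = 6 * derivation4 B (hodge3 \<alpha>) i j k l"
  proof -
    have ex: "(\<Sum>a\<in>UNIV. \<Sum>b\<in>UNIV. \<Sum>c\<in>UNIV. \<Sum>m\<in>UNIV. y m * F a b c m * \<alpha> a b c)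
       = (\<Sum>m\<in>UNIV. y m * (\<Sum>a\<in>UNIV. \<Sum>b\<in>UNIV. \<Sum>c\<in>UNIV. F a b c m * \<alpha> a b c))" for y :: "7 \<Rightarrow> real" and F
      unfolding sum_distrib_left sum.cartesian_product
      by (rule sum.reindex_bij_witness[of _ "\<lambda>(m,a,b,c). (a,b,c,m)" "\<lambda>(a,b,c,m). (m,a,b,c)"]) auto
    show ?thesis
      unfolding W_def derivation4_def hodge3_def sum_distrib_right distrib_right sum.distrib ex
      by (simp add: sum_divide_distrib[symmetric] distrib_left)
  qed
  finally show ?thesis
    unfolding hodge3_def[of "derivation3 A \<alpha>"] hodge3_def[of \<alpha> i j k l] V_def B_def[abs_def]
    by (simp add: diff_divide_distrib)
qed

lemma linear_axis_sum:
  fixes F :: "real^'n \<Rightarrow> real"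
  assumes "linear F"
  shows "(\<Sum>i\<in>UNIV. X $ i * F (axis i 1)) = F X"
proof -
  have "F X = F (\<Sum>i\<in>UNIV. X $ i *\<^sub>R axis i 1)"
    using basis_expansion[of X] by (simp add: scalar_mult_eq_scaleR)
  then show ?thesis
    by (simp add: linear_sum[OF assms] linear_cmul[OF assms])
qed

abbreviation ax :: "7 \<Rightarrow> real^7" where "ax i \<equiv> axis i 1"

lemma phi_std_eq: "phi_std i j k = cross7.phi (ax i) (ax j) (ax k)"
proof -
  have "cross7.phi (ax i) (ax j) (ax k) = cross7 (ax i) (ax j) $ k"
    by (simp add: inner_axis)
  also have "\<dots> = (\<Sum>p\<in>UNIV. \<Sum>q\<in>UNIV. (if p = i then 1 else 0) * ((if q = j then 1 else 0) * phi_std p q k))"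
    by (simp add: cross7_def axis_def mult.assoc)
  also have "\<dots> = (\<Sum>p\<in>UNIV. \<Sum>q\<in>UNIV. if q = j then if p = i then phi_std p q k else 0 else 0)"
    by (intro sum.cong) auto
  also have "\<dots> = phi_std i j k"
    by simp
  finally show ?thesis ..
qed

lemma phi_linear:
  "linear (\<lambda>x. cross7.phi x b c)" "linear (\<lambda>x. cross7.phi a x c)" "linear (\<lambda>x. cross7.phi a b x)"
  by (auto intro!: linearI simp: cross7.cr_linear inner_add_left inner_add_right)

lemma psi_linear:
  "linear (\<lambda>x. cross7.psi x b c d)" "linear (\<lambda>x. cross7.psi a x c d)"
  "linear (\<lambda>x. cross7.psi a b x d)" "linear (\<lambda>x. cross7.psi a b c x)"
  by (auto intro!: linearI simp: cross_psi_def cross7.cr_linear inner_add_left inner_add_right algebra_simps)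

lemma derivation3_phi:
  "derivation3 (\<lambda>i p. F (ax i) $ p) (\<lambda>i j k. cross7.phi (ax i) (ax j) (ax k)) i j k
    = cross7.phi (F (ax i)) (ax j) (ax k) + cross7.phi (ax i) (F (ax j)) (ax k) + cross7.phi (ax i) (ax j) (F (ax k))"
  unfolding derivation3_def sum.distrib
  by (simp only: linear_axis_sum[OF phi_linear(1)] linear_axis_sum[OF phi_linear(2)] linear_axis_sum[OF phi_linear(3)])

lemma derivation4_psi:
  "derivation4 (\<lambda>i p. F (ax i) $ p) (\<lambda>i j k l. cross7.psi (ax i) (ax j) (ax k) (ax l)) i j k l
    = cross7.psi (F (ax i)) (ax j) (ax k) (ax l) + cross7.psi (ax i) (F (ax j)) (ax k) (ax l)
     + cross7.psi (ax i) (ax j) (F (ax k)) (ax l) + cross7.psi (ax i) (ax j) (ax k) (F (ax l))"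
  unfolding derivation4_def sum.distrib
  by (simp only: linear_axis_sum[OF psi_linear(1)] linear_axis_sum[OF psi_linear(2)]
     linear_axis_sum[OF psi_linear(3)] linear_axis_sum[OF psi_linear(4)])

lemma hodge3_phi: "hodge3 (\<lambda>i j k. cross7.phi (ax i) (ax j) (ax k)) i j k l
    = cross7.psi (ax i) (ax j) (ax k) (ax l)"
  unfolding phi_std_eq[symmetric] by (rule hodge3_phi_std_eq)

lemma hodge3_scale: "hodge3 (\<lambda>i j k. r * \<alpha> i j k) i j k l = r * hodge3 \<alpha> i j k l"
  by (simp add: hodge3_def sum_distrib_left algebra_simps)

lemma hodge3_add:
  "hodge3 (\<lambda>i j k. \<alpha> i j k + \<beta> i j k) i j k l = hodge3 \<alpha> i j k l + hodge3 \<beta> i j k l"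
  by (simp add: hodge3_def distrib_left sum.distrib add_divide_distrib)

text \<open>
  The derivation belonging to the symmetric rank-one matrix \<open>e e\<^sup>T\<close> is \<open>\<alpha> \<mapsto> e \<and> (e \<lrcorner> \<alpha>)\<close>.
\<close>

lemma hodge3_phi_wedge:
  "hodge3 (\<lambda>i j k. cross7.phi_wedge e e (ax i) (ax j) (ax k)) i j k l
    = (e \<bullet> e) * cross7.psi (ax i) (ax j) (ax k) (ax l) - wedge1 e (cross7.psi e) (ax i) (ax j) (ax k) (ax l)"
proof -
  define F where "F v = (e \<bullet> v) *\<^sub>R e" for v
  have sym: "(\<lambda>p q. F (ax q) $ p) = (\<lambda>p q. F (ax p) $ q)"
    by (simp add: F_def inner_axis fun_eq_iff)
  have "derivation3 (\<lambda>i p. F (ax i) $ p) (\<lambda>i j k. cross7.phi (ax i) (ax j) (ax k))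
     = (\<lambda>i j k. cross7.phi_wedge e e (ax i) (ax j) (ax k))"
  proof (intro ext)
    fix i j k
    have "cross7.phi (ax i) e (ax k) = cross7.phi e (ax k) (ax i)" "cross7.phi (ax i) (ax j) e = cross7.phi e (ax i) (ax j)"
      by (rule cross7.phi_perm)+
    then show "derivation3 (\<lambda>i p. F (ax i) $ p) (\<lambda>i j k. cross7.phi (ax i) (ax j) (ax k)) i j k
     = cross7.phi_wedge e e (ax i) (ax j) (ax k)"
      unfolding derivation3_phi by (simp add: F_def cross7.phi_wedge_def cross7.cr_linear)
  qed
  moreover have "(\<Sum>m\<in>UNIV. F (ax m) $ m) = e \<bullet> e"
    unfolding inner_vec_def[of e e] by (simp add: F_def inner_axis)
  moreover have "derivation4 (\<lambda>p q. F (ax q) $ p) (hodge3 (\<lambda>i j k. cross7.phi (ax i) (ax j) (ax k))) i j k l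
    = wedge1 e (cross7.psi e) (ax i) (ax j) (ax k) (ax l)"
  proof -
    have "cross7.psi (ax i) e (ax k) (ax l) = - cross7.psi e (ax i) (ax k) (ax l)"
      "cross7.psi (ax i) (ax j) e (ax l) = cross7.psi e (ax i) (ax j) (ax l)"
      "cross7.psi (ax i) (ax j) (ax k) e = - cross7.psi e (ax i) (ax j) (ax k)"
      using cross7.psi_swap(1)[of "ax i" e] cross7.psi_swap(2)[of "ax i" "ax j" e] cross7.psi_swap(3)[of "ax i" "ax j" "ax k" e]
      by simp_all
    moreover have "cross7.psi (ax i) (r *\<^sub>R e) x y = r * cross7.psi (ax i) e x y"
       "cross7.psi (ax i) x (r *\<^sub>R e) y = r * cross7.psi (ax i) x e y"
       "cross7.psi (ax i) x y (r *\<^sub>R e) = r * cross7.psi (ax i) x y e" for x y r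
      by (simp_all add: linear_cmul[OF psi_linear(2)] linear_cmul[OF psi_linear(3)] linear_cmul[OF psi_linear(4)])
    ultimately show ?thesis
      unfolding sym hodge3_phi[abs_def] derivation4_psi by (simp add: F_def wedge1_def cross7.psi_linear1)
  qed
  ultimately show ?thesis
    using hodge3_derivation[of "\<lambda>i p. F (ax i) $ p" "\<lambda>i j k. cross7.phi (ax i) (ax j) (ax k)" i j k l]
    by (simp add: hodge3_phi)
qed

text \<open>
  The matrix of \<open>e \<times> \<cdot>\<close> is skew, hence trace-free, so its derivation commutes with the Hodge star; it
  maps \<open>\<phi>\<close> to \<open>- 3 (e \<lrcorner> \<psi>)\<close> and \<open>\<psi>\<close> to \<open>3 e \<and> \<phi>\<close>.
\<close>

lemma hodge3_psi:
  "hodge3 (\<lambda>i j k. cross7.psi e (ax i) (ax j) (ax k)) i j k l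
    = - wedge1 e cross7.phi (ax i) (ax j) (ax k) (ax l)"
proof -
  define F where "F = cross7 e"
  define G where "G v = - F v" for v
  have skew: "(\<lambda>p q. F (ax q) $ p) = (\<lambda>p q. G (ax p) $ q)"
  proof (intro ext)
    fix p q
    show "F (ax q) $ p = G (ax p) $ q"
      using cross7.phi_perm(4)[of e "ax q" "ax p"] by (simp add: F_def G_def inner_axis)
  qed
  have 1: "derivation3 (\<lambda>i p. F (ax i) $ p) (\<lambda>i j k. cross7.phi (ax i) (ax j) (ax k))
     = (\<lambda>i j k. - 3 * cross7.psi e (ax i) (ax j) (ax k))"
    by (intro ext) (simp only: derivation3_phi F_def cross7.cr_derivation_phi)
  have "F (ax m) $ m = 0" for m
    using cross7.phi_self(3)[of e "ax m"] by (simp add: F_def inner_axis)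
  then have 2: "(\<Sum>m\<in>UNIV. F (ax m) $ m) = 0"
    by simp
  have 3: "derivation4 (\<lambda>p q. F (ax q) $ p) (hodge3 (\<lambda>i j k. cross7.phi (ax i) (ax j) (ax k))) i j k l
    = - 3 * wedge1 e cross7.phi (ax i) (ax j) (ax k) (ax l)"
    unfolding skew hodge3_phi[abs_def] derivation4_psi
    using cross7.cr_derivation_psi[of e "ax i" "ax j" "ax k" "ax l"]
    by (simp add: G_def F_def linear_neg[OF psi_linear(1)] linear_neg[OF psi_linear(2)] linear_neg[OF psi_linear(3)] linear_neg[OF psi_linear(4)])
  show ?thesis
    using hodge3_derivation[of "\<lambda>i p. F (ax i) $ p" "\<lambda>i j k. cross7.phi (ax i) (ax j) (ax k)" i j k l]
    unfolding 1 2 3 hodge3_scale by simp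
qed

lemma hodge3_phi_rot:
  assumes "e \<bullet> e = 1"
  shows "hodge3 (\<lambda>i j k. cross7.phi_rot t e (ax i) (ax j) (ax k)) i j k l
    = cross7.psi_rot t e (ax i) (ax j) (ax k) (ax l)"
  unfolding cross7.phi_rot_def cross7.psi_rot_def hodge3_add hodge3_diff hodge3_scale hodge3_phi hodge3_psi hodge3_phi_wedge
  using assms by (simp add: algebra_simps)

lemma g2_isometric_eq_phi_rot:
  assumes e: "e \<bullet> e = 1"
  shows "g2_isometric phi_std (cos (t / 2)) (sin (t / 2) *\<^sub>R e) i j k = cross7.phi_rot t e (ax i) (ax j) (ax k)"
proof -
  have "norm e = 1"
    using e by (simp add: norm_eq_1)
  then have n: "(norm (sin (t / 2) *\<^sub>R e))\<^sup>2 = (sin (t / 2))\<^sup>2"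
    by simp
  have psi: "interior4 X (hodge3 phi_std) i j k = cross7.psi X (ax i) (ax j) (ax k)" for X
    unfolding interior4_def hodge3_phi_std_eq by (rule linear_axis_sum[OF psi_linear(1)])
  have phi: "interior3 X phi_std j k = cross7.phi X (ax j) (ax k)" for X j k
    unfolding interior3_def phi_std_eq by (rule linear_axis_sum[OF phi_linear(1)])
  have w: "wedge12 (flat (r *\<^sub>R e)) (interior3 (r *\<^sub>R e) phi_std) i j k = r\<^sup>2 * cross7.phi_wedge e e (ax i) (ax j) (ax k)" for r
    unfolding wedge12_def phi flat_def cross7.phi_wedge_def by (simp add: inner_axis cross7.cr_linear algebra_simps power2_eq_square)
  have c: "cos t = (cos (t / 2))\<^sup>2 - (sin (t / 2))\<^sup>2" "sin t = 2 * sin (t / 2) * cos (t / 2)"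
    using cos_double[of "t / 2"] sin_double[of "t / 2"] by simp_all
  have c2: "1 - cos t = 2 * (sin (t / 2))\<^sup>2"
    using cos_double_sin[of "t / 2"] by simp
  show ?thesis
    unfolding g2_isometric_def cross7.phi_rot_def n psi w c2
    unfolding c phi_std_eq cross7.psi_linear1 by simp
qed

section \<open>The profile equation\<close>

lemma gaussian_dominates:
  fixes k c :: real
  assumes "0 < k" "0 < c"
  shows "filterlim (\<lambda>s. k * exp (c * s\<^sup>2 / 2) / s\<^sup>2 - 4 * s ^ 3) at_top at_top"
  using assms by real_asymp

text \<open>
  Solutions of the profile equation. The derivatives are parameters, so that the theory applies to \<open>u\<close> and
  to \<open>-u\<close>.
\<close>

locale radial_profile =
  fixes c :: real and u u1 u2 :: "real \<Rightarrow> real"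
  assumes deriv_u: "(u has_real_derivative u1 r) (at r)"
    and deriv_u1: "(u1 has_real_derivative u2 r) (at r)"
    and ode: "r\<^sup>2 * u2 r + (6 - c * r\<^sup>2) * r * u1 r - 6 * sin (u r) = 0"
begin

text \<open>
  The energy \<open>E\<close> of the pendulum that the equation describes in the variable \<open>log r\<close>, where \<open>r u'\<close> is the
  velocity, decreases because the friction coefficient \<open>5 - c r\<^sup>2\<close> is positive. At the origin \<open>E \<le> 6\<close>.
\<close>

lemma steady_or_expanding_bound:
  assumes "c \<le> 0" "r \<ge> 0"
  shows "(r * u1 r)\<^sup>2 \<le> 24"
proof -
  define E where "E r = (r * u1 r)\<^sup>2 / 2 + 6 * cos (u r)" for r
  have "(E has_real_derivative - (5 - c * r\<^sup>2) * r * (u1 r)\<^sup>2) (at r)" for r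
  proof -
    have "(E has_real_derivative u1 r * (r * u1 r + r\<^sup>2 * u2 r - 6 * sin (u r))) (at r)"
      unfolding E_def
      by (auto intro!: derivative_eq_intros deriv_u deriv_u1 simp: power2_eq_square algebra_simps)
    moreover have "u1 r * (r * u1 r + r\<^sup>2 * u2 r - 6 * sin (u r)) = - (5 - c * r\<^sup>2) * r * (u1 r)\<^sup>2"
      using ode[of r] by algebra
    ultimately show ?thesis
      by simp
  qed
  moreover have "- (5 - c * s\<^sup>2) * s * (u1 s)\<^sup>2 \<le> 0" if "s \<ge> 0" for s
  proof -
    have "c * s\<^sup>2 \<le> 0"
      using \<open>c \<le> 0\<close> by (simp add: mult_nonpos_nonneg)
    then have "0 \<le> (5 - c * s\<^sup>2) * s * (u1 s)\<^sup>2"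
      using that by (intro mult_nonneg_nonneg) auto
    then show ?thesis
      by (simp only: mult_minus_left neg_le_0_iff_le)
  qed
  ultimately have "E r \<le> E 0"
    using DERIV_nonpos_imp_nonincreasing[of 0 r E] \<open>r \<ge> 0\<close> by blast
  then show ?thesis
    using cos_le_one[of "u 0"] cos_ge_minus_one[of "u r"] unfolding E_def zero_power2 mult_zero_left by linarith
qed

text \<open>
  \<open>p\<close> is the quotient of the velocity \<open>r u'\<close> by the comparison solution \<open>r\<^sup>-\<^sup>2\<close>, \<open>p1\<close> is \<open>p'\<close> with the second
  derivative eliminated by the equation, and \<open>Q\<close> is, up to sign, the weighted Wronskian of the two.
\<close>

definition p where "p r = r ^ 3 * u1 r"
definition p1 where "p1 r = (c * r\<^sup>2 - 3) * r\<^sup>2 * u1 r + 6 * r * sin (u r)"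
definition Q where "Q r = exp (- c * r\<^sup>2 / 2) * (r\<^sup>2 * p1 r)"

lemma deriv_p: "(p has_real_derivative p1 r) (at r)"
proof -
  have "(p has_real_derivative 3 * r\<^sup>2 * u1 r + r ^ 3 * u2 r) (at r)"
    unfolding p_def by (auto intro!: derivative_eq_intros deriv_u1)
  moreover have "3 * r\<^sup>2 * u1 r + r ^ 3 * u2 r = p1 r"
    unfolding p1_def using ode[of r] by algebra
  ultimately show ?thesis
    by simp
qed

lemma deriv_Q: "(Q has_real_derivative 6 * (1 + cos (u r)) * exp (- c * r\<^sup>2 / 2) * p r) (at r)"
proof -
  have "(Q has_real_derivative exp (- c * r\<^sup>2 / 2) * (- c * r * (r\<^sup>2 * p1 r)
      + 2 * r * p1 r + r\<^sup>2 * (2 * c * r * r\<^sup>2 * u1 r + (c * r\<^sup>2 - 3) * (2 * r * u1 r + r\<^sup>2 * u2 r)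
      + 6 * sin (u r) + 6 * r * cos (u r) * u1 r))) (at r)"
    unfolding Q_def p1_def
    by (rule derivative_eq_intros deriv_u deriv_u1 refl | simp)+ (simp add: algebra_simps power2_eq_square)
  moreover have "- c * r * (r\<^sup>2 * p1 r)
      + 2 * r * p1 r + r\<^sup>2 * (2 * c * r * r\<^sup>2 * u1 r + (c * r\<^sup>2 - 3) * (2 * r * u1 r + r\<^sup>2 * u2 r)
      + 6 * sin (u r) + 6 * r * cos (u r) * u1 r) = 6 * (1 + cos (u r)) * p r"
    unfolding p1_def p_def using ode[of r] by algebra
  ultimately show ?thesis
    by (simp add: mult_ac)
qed

lemma cont_p: "continuous_on S p"
  by (rule DERIV_continuous_on, rule has_field_derivative_at_within, rule deriv_p)

lemma cont_Q: "continuous_on S Q"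
  by (rule DERIV_continuous_on, rule has_field_derivative_at_within, rule deriv_Q)

lemma cont_u1: "continuous_on S u1"
  by (rule DERIV_continuous_on, rule has_field_derivative_at_within, rule deriv_u1)

lemma p1_Q: "r \<noteq> 0 \<Longrightarrow> p1 r = Q r * exp (c * r\<^sup>2 / 2) / r\<^sup>2"
  by (simp add: Q_def field_simps flip: exp_add)

lemma Q_mono:
  assumes "0 \<le> a" "a \<le> b" "\<And>r. a < r \<Longrightarrow> r < b \<Longrightarrow> 0 \<le> u1 r"
  shows "Q a \<le> Q b"
proof (rule DERIV_nonneg_imp_increasing_open[OF \<open>a \<le> b\<close> _ cont_Q])
  fix r assume r: "a < r" "r < b"
  have "0 \<le> 1 + cos (u r)"
    using cos_ge_minus_one[of "u r"] by linarith
  then have "0 \<le> 6 * (1 + cos (u r)) * exp (- c * r\<^sup>2 / 2) * p r"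
    using r assms by (simp add: p_def)
  with deriv_Q show "\<exists>y. DERIV Q r :> y \<and> y \<ge> 0"
    by blast
qed

text \<open>
  At a first point \<open>R\<close> with \<open>u' \<le> 0\<close> one would have \<open>p(R) \<le> 0\<close>, but up to \<open>R\<close> the function \<open>Q\<close> increases from
  \<open>Q(0) = 0\<close>, so that \<open>p\<close>, which is positive before \<open>R\<close>, increases as well.
\<close>

lemma u1_pos:
  assumes "u1 0 > 0" "r \<ge> 0"
  shows "u1 r > 0"
proof (rule ccontr)
  assume "\<not> u1 r > 0"
  define S where "S = {0..r} \<inter> u1 -` {..0}"
  have "compact S"
    unfolding S_def
    by (simp add: compact_eq_bounded_closed bounded_Int continuous_closed_preimage cont_u1)
  moreover have "r \<in> S"
    using \<open>\<not> u1 r > 0\<close> \<open>r \<ge> 0\<close> by (simp add: S_def)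
  ultimately obtain R where R: "R \<in> S" "\<And>s. s \<in> S \<Longrightarrow> R \<le> s"
    using compact_attains_inf[of S] by blast
  have S: "s \<in> S \<longleftrightarrow> 0 \<le> s \<and> s \<le> r \<and> u1 s \<le> 0" for s
    by (auto simp: S_def)
  then have "0 \<le> R" "R \<le> r" "u1 R \<le> 0"
    using R(1) by blast+
  moreover from this have "R \<noteq> 0"
    using \<open>u1 0 > 0\<close> by fastforce
  ultimately have "R > 0"
    by linarith
  have pos: "u1 s > 0" if "0 \<le> s" "s < R" for s
    using R(2)[of s] S[of s] that \<open>R \<le> r\<close> by linarith
  have "p (R / 2) \<le> p R"
  proof (rule DERIV_nonneg_imp_increasing_open[OF _ _ cont_p])
    show "R / 2 \<le> R"
      using \<open>R > 0\<close> by simp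
    fix s assume s: "R / 2 < s" "s < R"
    have "Q 0 \<le> Q s"
      using s \<open>R > 0\<close> pos by (intro Q_mono) (auto intro: less_imp_le)
    then have "0 \<le> Q s"
      by (simp add: Q_def[of 0])
    then have "0 \<le> p1 s"
      using s \<open>R > 0\<close> by (subst p1_Q) auto
    with deriv_p show "\<exists>y. DERIV p s :> y \<and> y \<ge> 0"
      by blast
  qed
  moreover have "p (R / 2) > 0"
    using pos[of "R / 2"] \<open>R > 0\<close> by (simp add: p_def)
  moreover have "p R \<le> 0"
    using \<open>R > 0\<close> \<open>u1 R \<le> 0\<close> by (simp add: p_def mult_le_0_iff)
  ultimately show False
    by simp
qed

text \<open>
  Near the origin \<open>|u| < \<pi>\<close>, hence \<open>1 + cos u > 0\<close> and \<open>Q\<close> becomes strictly positive. From then on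
  \<open>p' \<ge> const e\<^bsup>cr\<^sup>2/2\<^esup> / r\<^sup>2\<close>, which exceeds \<open>4 r\<^sup>3\<close> eventually, so \<open>p \<ge> r\<^sup>4 - K\<close> and \<open>u' \<ge> r - K\<close>.
\<close>

lemma shrinking_unbounded:
  assumes "c > 0" "u1 0 > 0" "u 0 = 0"
  shows "filterlim u1 at_top at_top"
proof -
  have "isCont u 0"
    using deriv_u DERIV_isCont by blast
  then have "\<exists>d>0. \<forall>s. dist s 0 < d \<longrightarrow> dist (u s) (u 0) < pi"
    unfolding continuous_at_eps_delta dist_real_def using pi_gt_zero by blast
  then obtain d where d: "d > 0" "\<And>s. \<bar>s\<bar> < d \<Longrightarrow> \<bar>u s\<bar> < pi"
    by (auto simp: \<open>u 0 = 0\<close>)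
  define a where "a = d / 2"
  have "a > 0"
    using d by (simp add: a_def)
  have "Q 0 < Q a"
  proof (rule DERIV_pos_imp_increasing_open[OF \<open>a > 0\<close> _ cont_Q])
    fix s assume s: "0 < s" "s < a"
    then have "\<bar>u s\<bar> < pi"
      using d by (simp add: a_def)
    then have "- 1 < cos (u s)"
      using cos_monotone_0_pi[of "\<bar>u s\<bar>" pi] by simp
    then have "0 < 6 * (1 + cos (u s)) * exp (- c * s\<^sup>2 / 2) * p s"
      using s u1_pos[of s] assms by (simp add: p_def)
    with deriv_Q show "\<exists>y. DERIV Q s :> y \<and> y > 0"
      by blast
  qed
  then have "Q a > 0"
    by (simp add: Q_def)
  have Q: "Q a \<le> Q s" if "s \<ge> a" for s
    using that \<open>a > 0\<close> by (intro Q_mono) (auto intro!: less_imp_le u1_pos assms)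
  have "filterlim (\<lambda>s. Q a * exp (c * s\<^sup>2 / 2) / s\<^sup>2 - 4 * s ^ 3) at_top at_top"
    using \<open>Q a > 0\<close> \<open>c > 0\<close> by (rule gaussian_dominates)
  then have "eventually (\<lambda>s. 0 \<le> Q a * exp (c * s\<^sup>2 / 2) / s\<^sup>2 - 4 * s ^ 3) at_top"
    unfolding filterlim_at_top by blast
  then obtain M0 where M0: "\<And>s. s \<ge> M0 \<Longrightarrow> 0 \<le> Q a * exp (c * s\<^sup>2 / 2) / s\<^sup>2 - 4 * s ^ 3"
    unfolding eventually_at_top_linorder by blast
  define M where "M = max (max a M0) 1"
  define K where "K = \<bar>p M - M ^ 4\<bar>"
  have "s - K \<le> u1 s" if "s \<ge> M" for s
  proof -
    have "p M - M ^ 4 \<le> p s - s ^ 4"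
    proof (rule DERIV_nonneg_imp_nondecreasing[OF that])
      fix x assume x: "M \<le> x" "x \<le> s"
      have D: "((\<lambda>x. p x - x ^ 4) has_real_derivative p1 x - 4 * x ^ 3) (at x)"
        by (auto intro!: derivative_eq_intros deriv_p)
      have "Q a * exp (c * x\<^sup>2 / 2) / x\<^sup>2 \<le> p1 x"
        using x Q[of x] by (subst p1_Q) (auto simp: M_def divide_right_mono)
      with M0[of x] x D show "\<exists>y. DERIV (\<lambda>x. p x - x ^ 4) x :> y \<and> 0 \<le> y"
        by (intro exI[of _ "p1 x - 4 * x ^ 3"]) (auto simp: M_def)
    qed
    moreover have "- K \<le> p M - M ^ 4"
      by (simp add: K_def)
    moreover have s: "s \<ge> 1"
      using that by (simp add: M_def)
    moreover have "K * 1 \<le> K * s ^ 3"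
      using s by (intro mult_left_mono) (auto simp: K_def)
    moreover have "s ^ 3 * (s - K) = s ^ 4 - K * s ^ 3"
      by (simp add: right_diff_distrib eval_nat_numeral)
    ultimately have "s ^ 3 * (s - K) \<le> s ^ 3 * u1 s"
      unfolding p_def[of s] by linarith
    then show ?thesis
      using s by simp
  qed
  then have "eventually (\<lambda>s. s - K \<le> u1 s) at_top"
    unfolding eventually_at_top_linorder by blast
  moreover have "filterlim (\<lambda>s. s - K) at_top at_top"
    by real_asymp
  ultimately show ?thesis
    using filterlim_at_top_mono by blast
qed

end

section \<open>The torsion of the radial structure\<close>

lemma psi_rot_linear:
  "linear (\<lambda>x. cross7.psi_rot t e x b c d)" "linear (\<lambda>x. cross7.psi_rot t e a x c d)"
  "linear (\<lambda>x. cross7.psi_rot t e a b x d)" "linear (\<lambda>x. cross7.psi_rot t e a b c x)"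
  by (auto intro!: linearI simp: cross7.psi_rot_def wedge1_def cross_psi_def cross7.cr_linear
      inner_add_left inner_add_right algebra_simps)

lemma linear_eq_0_on_axes:
  fixes F :: "real^'n \<Rightarrow> real"
  assumes "linear F" "\<And>i. F (axis i 1) = 0"
  shows "F X = 0"
  using linear_axis_sum[OF assms(1), of X] assms(2) by simp

lemma has_derivative_norm_line:
  fixes x a :: "'a::real_inner"
  assumes "x \<noteq> 0"
  shows "((\<lambda>t. norm (x + t *\<^sub>R a)) has_real_derivative sgn x \<bullet> a) (at 0)"
proof -
  have "((\<lambda>t. norm (x + t *\<^sub>R a)) has_derivative (\<lambda>h. h * (sgn x \<bullet> a))) (at 0)"
  proof -
    have "((\<lambda>t. x + t *\<^sub>R a) has_derivative (\<lambda>h. h *\<^sub>R a)) (at 0)"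
      by (auto intro!: derivative_eq_intros)
    moreover have "(norm has_derivative (\<lambda>h. sgn x \<bullet> h)) (at (x + 0 *\<^sub>R a))"
      using assms by (simp add: has_derivative_norm inner_commute)
    ultimately show ?thesis
      using has_derivative_compose by fastforce
  qed
  then show ?thesis
    by (simp add: has_field_derivative_def mult_commute_abs)
qed

lemma has_derivative_sgn_line:
  fixes x a :: "'a::real_inner" and F :: "'a \<Rightarrow> real"
  assumes "x \<noteq> 0" "linear F"
  shows "((\<lambda>t. F (sgn (x + t *\<^sub>R a))) has_real_derivative
     F ((1 / norm x) *\<^sub>R (a - (sgn x \<bullet> a) *\<^sub>R sgn x))) (at 0)"
proof -
  have F: "F (sgn (x + t *\<^sub>R a)) = (F x + t * F a) / norm (x + t *\<^sub>R a)" for t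
    by (simp add: sgn_div_norm linear_cmul[OF assms(2)] linear_add[OF assms(2)] divide_inverse mult.commute)
  have "((\<lambda>t. F (sgn (x + t *\<^sub>R a))) has_real_derivative
     (F a * norm x - F x * (sgn x \<bullet> a)) / (norm x * norm x)) (at 0)"
    unfolding F using assms(1)
    by (auto intro!: derivative_eq_intros has_derivative_norm_line)
  also have "(F a * norm x - F x * (sgn x \<bullet> a)) / (norm x * norm x)
     = F ((1 / norm x) *\<^sub>R (a - (sgn x \<bullet> a) *\<^sub>R sgn x))"
    using assms(1)
    by (simp add: linear_cmul[OF assms(2)] linear_diff[OF assms(2)] sgn_div_norm field_simps)
  finally show ?thesis .
qed

lemma sgn_inner_self: "x \<noteq> 0 \<Longrightarrow> sgn x \<bullet> sgn x = 1" for x :: "'a::real_inner"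
  using norm_sgn[of x] by (simp add: norm_eq_1)

lemma radial_g2_eq_phi_rot:
  assumes "x \<noteq> 0"
  shows "radial_g2 u x i j k = cross7.phi_rot (u (norm x)) (sgn x) (ax i) (ax j) (ax k)"
  unfolding radial_g2_def radial_f_def radial_X_def
  using assms by (intro g2_isometric_eq_phi_rot sgn_inner_self)

text \<open>
  The row of the torsion in the direction \<open>a\<close>: the vector \<open>Z\<close> with \<open>\<nabla>\<^sub>a \<phi> = Z \<lrcorner> \<star>\<phi>\<close>.
\<close>

definition radial_torsion :: "(real \<Rightarrow> real) \<Rightarrow> real^7 \<Rightarrow> real^7 \<Rightarrow> real^7" where
  "radial_torsion u x a =
     (let e = sgn x; w = (1 / norm x) *\<^sub>R (a - (e \<bullet> a) *\<^sub>R e); t = u (norm x)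
      in (- deriv u (norm x) * (e \<bullet> a)) *\<^sub>R e + (- sin t *\<^sub>R w + (1 - cos t) *\<^sub>R cross7 e w))"

lemma nabla3_radial_g2:
  assumes x: "x \<noteq> 0" and u: "\<And>r. (u has_real_derivative deriv u r) (at r)"
  shows "nabla3 (radial_g2 u) x p i j k =
    cross7.psi_rot (u (norm x)) (sgn x) (radial_torsion u x (ax p)) (ax i) (ax j) (ax k)"
proof -
  define e where "e = sgn x"
  define w where "w = (1 / norm x) *\<^sub>R (ax p - (e \<bullet> ax p) *\<^sub>R e)"
  define t where "t = u (norm x)"
  define t' where "t' = deriv u (norm x) * (e \<bullet> ax p)"
  define a b c where "a = ax i" and "b = ax j" and "c = ax k"
  define y where "y s = x + s *\<^sub>R ax p" for s
  have e: "e \<bullet> e = 1"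
    unfolding e_def using x by (rule sgn_inner_self)
  have ew: "e \<bullet> w = 0"
    by (simp add: w_def inner_diff_right e)
  have y0: "y 0 = x"
    by (simp add: y_def)
  have angle: "((\<lambda>s. u (norm (y s))) has_real_derivative t') (at 0)"
    unfolding t'_def y_def e_def using u[of "norm x"] has_derivative_norm_line[OF x, of "ax p"]
    by (intro DERIV_chain2[where f = u]) simp_all
  have dir: "((\<lambda>s. F (sgn (y s))) has_real_derivative F w) (at 0)" if "linear F" for F :: "real^7 \<Rightarrow> real"
    unfolding y_def w_def e_def by (rule has_derivative_sgn_line[OF x that])
  have dpsi: "((\<lambda>s. cross7.psi (sgn (y s)) a b c) has_real_derivative cross7.psi w a b c) (at 0)"
    by (rule dir[OF psi_linear(1)])
  have dphi: "((\<lambda>s. cross7.phi (sgn (y s)) b c) has_real_derivative cross7.phi w b c) (at 0)" for b c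
    by (rule dir[OF phi_linear(1)])
  have dinner: "((\<lambda>s. sgn (y s) \<bullet> a) has_real_derivative w \<bullet> a) (at 0)" for a
    by (rule dir) (auto intro!: linearI simp: inner_add_left)
  have dwedge: "((\<lambda>s. cross7.phi_wedge (sgn (y s)) (sgn (y s)) a b c) has_real_derivative
      cross7.phi_wedge w e a b c + cross7.phi_wedge e w a b c) (at 0)"
    unfolding cross7.phi_wedge_def e_def
    by (rule derivative_eq_intros dphi dinner refl)+ (simp add: y0 algebra_simps)
  have "((\<lambda>s. cross7.phi_rot (u (norm (y s))) (sgn (y s)) a b c) has_real_derivative
      t' * (- sin t * cross7.phi a b c - cos t * cross7.psi e a b c + sin t * cross7.phi_wedge e e a b c)
      + (- sin t * cross7.psi w a b c
          + (1 - cos t) * (cross7.phi_wedge w e a b c + cross7.phi_wedge e w a b c))) (at 0)"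
    unfolding cross7.phi_rot_def
    by (rule derivative_eq_intros angle dpsi dwedge refl)+ (simp add: y0 t_def[symmetric] e_def[symmetric] algebra_simps)
  also have "t' * (- sin t * cross7.phi a b c - cos t * cross7.psi e a b c + sin t * cross7.phi_wedge e e a b c)
      + (- sin t * cross7.psi w a b c
          + (1 - cos t) * (cross7.phi_wedge w e a b c + cross7.phi_wedge e w a b c))
      = cross7.psi_rot t e (radial_torsion u x (ax p)) a b c"
    unfolding cross7.phi_rot_angle_variation[OF e] cross7.phi_rot_axis_variation[OF e ew]
      radial_torsion_def Let_def e_def[symmetric] t_def[symmetric] w_def[symmetric]
    by (simp add: linear_add[OF psi_rot_linear(1)] linear_diff[OF psi_rot_linear(1)]
        linear_neg[OF psi_rot_linear(1)] linear_cmul[OF psi_rot_linear(1)] t'_def)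
  finally have D: "((\<lambda>s. cross7.phi_rot (u (norm (y s))) (sgn (y s)) a b c) has_real_derivative
     cross7.psi_rot t e (radial_torsion u x (ax p)) a b c) (at 0)" .
  have "eventually (\<lambda>s. y s \<noteq> 0) (nhds 0)"
  proof -
    have "open {s. y s \<noteq> 0}"
      unfolding y_def by (intro open_Collect_neq continuous_intros)
    then show ?thesis
      using eventually_nhds_in_open[of "{s. y s \<noteq> 0}" 0] x by (simp add: y0)
  qed
  then have ev: "eventually (\<lambda>s. radial_g2 u (y s) i j k = cross7.phi_rot (u (norm (y s))) (sgn (y s)) a b c) (nhds 0)"
    by eventually_elim (simp add: radial_g2_eq_phi_rot a_def b_def c_def)
  have "((\<lambda>s. radial_g2 u (y s) i j k) has_real_derivative
     cross7.psi_rot t e (radial_torsion u x (ax p)) a b c) (at 0)"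
    using D DERIV_cong_ev[OF refl ev refl] by blast
  then show ?thesis
    unfolding nabla3_def y_def[symmetric] t_def[symmetric] e_def[symmetric] a_def[symmetric] b_def[symmetric] c_def[symmetric]
    by (rule DERIV_imp_deriv)
qed

lemma exists_orthogonal_to_three:
  fixes x y z :: "real^7"
  shows "\<exists>v. v \<noteq> 0 \<and> v \<bullet> x = 0 \<and> v \<bullet> y = 0 \<and> v \<bullet> z = 0"
proof -
  have "dim {x, y, z} \<le> card {x, y, z}"
    by (rule dim_le_card') simp
  also have "\<dots> \<le> 3"
    by (simp add: card_insert_if)
  finally have "dim {x, y, z} < DIM(real^7)"
    by simp
  then obtain v where "v \<noteq> 0" "\<And>w. w \<in> span {x, y, z} \<Longrightarrow> orthogonal v w"
    using orthogonal_to_subspace_exists by metis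
  then show ?thesis
    by (intro exI[of _ v]) (auto simp: orthogonal_def span_base)
qed

lemma torsion_radial_g2:
  assumes x: "x \<noteq> 0" and u: "\<And>r. (u has_real_derivative deriv u r) (at r)"
  shows "torsion (radial_g2 u) x p q = radial_torsion u x (ax p) $ q"
proof -
  define t e where "t = u (norm x)" and "e = sgn x"
  have e: "e \<bullet> e = 1"
    unfolding e_def using x by (rule sgn_inner_self)
  have "radial_g2 u x = (\<lambda>i j k. cross7.phi_rot t e (ax i) (ax j) (ax k))"
    unfolding t_def e_def by (intro ext radial_g2_eq_phi_rot x)
  then have hodge: "hodge3 (radial_g2 u x) q i j k = cross7.psi_rot t e (ax q) (ax i) (ax j) (ax k)" for q i j k
    by (simp add: hodge3_phi_rot[OF e])
  have contract: "(\<Sum>q\<in>UNIV. S q * hodge3 (radial_g2 u x) q i j k)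
     = cross7.psi_rot t e (\<chi> q. S q) (ax i) (ax j) (ax k)" for S i j k
    unfolding hodge using linear_axis_sum[OF psi_rot_linear(1), of "\<chi> q. S q"] by simp
  have nabla: "nabla3 (radial_g2 u) x p i j k = cross7.psi_rot t e (radial_torsion u x (ax p)) (ax i) (ax j) (ax k)"
    for p i j k
    unfolding t_def e_def by (rule nabla3_radial_g2[OF x u])
  have "torsion (radial_g2 u) x = (\<lambda>p q. radial_torsion u x (ax p) $ q)"
    unfolding torsion_def
  proof (rule the_equality)
    show "\<forall>p i j k. nabla3 (radial_g2 u) x p i j k
      = (\<Sum>q\<in>UNIV. radial_torsion u x (ax p) $ q * hodge3 (radial_g2 u x) q i j k)"
      unfolding contract nabla by simp
  next
    fix S assume S: "\<forall>p i j k. nabla3 (radial_g2 u) x p i j k = (\<Sum>q\<in>UNIV. S p q * hodge3 (radial_g2 u x) q i j k)"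
    show "S = (\<lambda>p q. radial_torsion u x (ax p) $ q)"
    proof (rule ext)
      fix p
      define Z where "Z = (\<chi> q. S p q) - radial_torsion u x (ax p)"
      have "cross7.psi_rot t e Z (ax i) (ax j) (ax k) = 0" for i j k
        using S unfolding contract nabla Z_def by (simp add: linear_diff[OF psi_rot_linear(1)])
      then have "cross7.psi_rot t e Z a (ax j) (ax k) = 0" for a j k
        by (rule linear_eq_0_on_axes[OF psi_rot_linear(2)])
      then have "cross7.psi_rot t e Z a b (ax k) = 0" for a b k
        by (rule linear_eq_0_on_axes[OF psi_rot_linear(3)])
      then have "cross7.psi_rot t e Z a b c = 0" for a b c
        by (rule linear_eq_0_on_axes[OF psi_rot_linear(4)])
      then have "Z = 0"
        by (rule cross7.psi_rot_injective[OF e exists_orthogonal_to_three])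
      then show "S p = (\<lambda>q. radial_torsion u x (ax p) $ q)"
        by (simp add: Z_def vec_eq_iff fun_eq_iff)
    qed
  qed
  then show ?thesis
    by simp
qed

text \<open>
  The vectors \<open>e\<close>, \<open>w\<close> and \<open>e \<times> w\<close> in \<open>radial_torsion\<close> are orthogonal and \<open>|e \<times> w| = |w|\<close>. In the
  sum over a basis, \<open>(e \<bullet> a)\<^sup>2\<close> contributes \<open>1\<close> and \<open>|a|\<^sup>2 - (e \<bullet> a)\<^sup>2\<close> contributes \<open>6\<close>.
\<close>

lemma torsion_norm_sq_radial_g2:
  assumes x: "x \<noteq> 0" and u: "\<And>r. (u has_real_derivative deriv u r) (at r)"
  shows "torsion_norm_sq (radial_g2 u) x
    = (deriv u (norm x))\<^sup>2 + 24 * (sin (u (norm x) / 2))\<^sup>2 / (norm x)\<^sup>2"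
proof -
  define t e t' where "t = u (norm x)" and "e = sgn x" and "t' = deriv u (norm x)"
  have e: "e \<bullet> e = 1"
    unfolding e_def using x by (rule sgn_inner_self)
  have half: "2 * (1 - cos t) = 4 * (sin (t / 2))\<^sup>2"
    using cos_double_sin[of "t / 2"] by simp
  have row: "(\<Sum>q\<in>UNIV. (radial_torsion u x a $ q)\<^sup>2)
     = t'\<^sup>2 * (e \<bullet> a)\<^sup>2 + 4 * (sin (t / 2))\<^sup>2 * (a \<bullet> a - (e \<bullet> a)\<^sup>2) / (norm x)\<^sup>2" for a
  proof -
    define w where "w = (1 / norm x) *\<^sub>R (a - (e \<bullet> a) *\<^sub>R e)"
    have ew: "e \<bullet> w = 0" "w \<bullet> e = 0"
      by (simp_all add: w_def inner_diff_right inner_diff_left inner_commute[of a e] e)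
    have ww: "w \<bullet> w = (a \<bullet> a - (e \<bullet> a)\<^sup>2) / (norm x)\<^sup>2"
      by (simp add: w_def inner_diff_right inner_diff_left inner_commute[of a e] e power2_eq_square)
    have m: "cross7 e w \<bullet> cross7 e w = w \<bullet> w" "cross7 e w \<bullet> e = 0" "e \<bullet> cross7 e w = 0"
        "cross7 e w \<bullet> w = 0" "w \<bullet> cross7 e w = 0"
      using cross7.cr_orthogonal[of e w] by (simp_all add: cross7.lagrange e ew inner_commute)
    have sc: "cos t * (cos t * z) + sin t * (sin t * z) = z" for z
      using sin_cos_squared_add[of t] by algebra
    define v where "v = (- t' * (e \<bullet> a)) *\<^sub>R e + (- sin t *\<^sub>R w + (1 - cos t) *\<^sub>R cross7 e w)"
    have "radial_torsion u x a = v"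
      by (simp add: radial_torsion_def Let_def t_def e_def w_def t'_def v_def)
    then have "(\<Sum>q\<in>UNIV. (radial_torsion u x a $ q)\<^sup>2) = v \<bullet> v"
      by (simp add: inner_vec_def power2_eq_square)
    also have "v \<bullet> v = t'\<^sup>2 * (e \<bullet> a)\<^sup>2 + ((sin t)\<^sup>2 + (1 - cos t)\<^sup>2) * (w \<bullet> w)"
      unfolding v_def by (simp add: inner_add_left inner_add_right m ew e power2_eq_square algebra_simps sc)
    also have "(sin t)\<^sup>2 + (1 - cos t)\<^sup>2 = 4 * (sin (t / 2))\<^sup>2"
      unfolding half[symmetric] using sin_cos_squared_add[of t] by (simp add: power2_eq_square algebra_simps)
    finally show ?thesis
      unfolding ww by simp
  qed
  have "(\<Sum>p\<in>UNIV. (e \<bullet> ax p)\<^sup>2) = e \<bullet> e"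
    unfolding inner_vec_def[of e e] by (simp add: inner_axis power2_eq_square)
  moreover have "(\<Sum>p\<in>(UNIV::7 set). ax p \<bullet> ax p) = 7"
    by (simp add: inner_axis_axis)
  ultimately show ?thesis
    unfolding torsion_norm_sq_def torsion_radial_g2[OF x u] row t_def[symmetric] t'_def[symmetric]
      sum.distrib sum_divide_distrib[symmetric] sum_distrib_left[symmetric] sum_subtractf
    by (simp add: e)
qed

section \<open>Behaviour of the torsion at infinity\<close>

theorem proposition3p19:
  fixes c :: real and u :: "real \<Rightarrow> real"
  assumes "smooth u"
    and "\<And>r. u (- r) = - u r"
    and "deriv u 0 \<noteq> 0"
    and "\<And>r. r\<^sup>2 * deriv (deriv u) r + (6 - c * r\<^sup>2) * r * deriv u r - 6 * sin (u r) = 0"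
  shows "(c \<le> 0 \<longrightarrow> (torsion_norm_sq (radial_g2 u) \<longlongrightarrow> 0) at_infinity) \<and>
    (c > 0 \<longrightarrow> filterlim (torsion_norm_sq (radial_g2 u)) at_top at_infinity)"
proof -
  have D: "(u has_real_derivative deriv u r) (at r)" "(deriv u has_real_derivative deriv (deriv u) r) (at r)" for r
    using assms(1)[unfolded smooth_def, rule_format, of 0 r] assms(1)[unfolded smooth_def, rule_format, of 1 r]
    by (simp_all add: DERIV_deriv_iff_real_differentiable)
  have u0: "u 0 = 0"
    using assms(2)[of 0] by simp
  interpret pos: radial_profile c u "deriv u" "deriv (deriv u)"
    by unfold_locales (rule D assms(4))+
  interpret neg: radial_profile c "\<lambda>r. - u r" "\<lambda>r. - deriv u r" "\<lambda>r. - deriv (deriv u) r"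
  proof
    fix r show "r\<^sup>2 * - deriv (deriv u) r + (6 - c * r\<^sup>2) * r * - deriv u r - 6 * sin (- u r) = 0"
      using assms(4)[of r] by (simp add: algebra_simps)
  qed (auto intro!: derivative_eq_intros D)
  have T: "eventually (\<lambda>x. torsion_norm_sq (radial_g2 u) x =
      (deriv u (norm x))\<^sup>2 + 24 * (sin (u (norm x) / 2))\<^sup>2 / (norm x)\<^sup>2) at_infinity"
    unfolding eventually_at_infinity
    by (intro exI[of _ 1]) (auto intro!: torsion_norm_sq_radial_g2 D)
  show ?thesis
  proof (intro conjI impI)
    assume "c \<le> 0"
    have "(torsion_norm_sq (radial_g2 u) \<longlongrightarrow> 0) at_infinity"
    proof (rule tendsto_sandwich)
      show "eventually (\<lambda>x. 0 \<le> torsion_norm_sq (radial_g2 u) x) at_infinity"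
        by (simp add: torsion_norm_sq_def sum_nonneg)
      show "eventually (\<lambda>x. torsion_norm_sq (radial_g2 u) x \<le> 48 * (inverse (norm x))\<^sup>2) at_infinity"
        using T eventually_not_equal_at_infinity[of 0]
      proof eventually_elim
        case (elim x)
        have "(norm x * deriv u (norm x))\<^sup>2 \<le> 24"
          using \<open>c \<le> 0\<close> by (rule pos.steady_or_expanding_bound) simp
        moreover have "(sin (u (norm x) / 2))\<^sup>2 \<le> 1"
          by (simp add: abs_square_le_1)
        ultimately have "(norm x * deriv u (norm x))\<^sup>2 + 24 * (sin (u (norm x) / 2))\<^sup>2 \<le> 48"
          by linarith
        then show ?case
          using elim by (simp add: field_simps power_mult_distrib)
      qed
      have "((\<lambda>x::real^7. inverse (norm x)) \<longlongrightarrow> 0) at_infinity"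
        by (rule tendsto_inverse_0_at_top[OF filterlim_norm_at_top])
      then have "((\<lambda>x::real^7. 48 * (inverse (norm x))\<^sup>2) \<longlongrightarrow> 48 * 0\<^sup>2) at_infinity"
        by (intro tendsto_intros)
      then show "((\<lambda>x::real^7. 48 * (inverse (norm x))\<^sup>2) \<longlongrightarrow> 0) at_infinity"
        by simp
    qed simp
    then show "(torsion_norm_sq (radial_g2 u) \<longlongrightarrow> 0) at_infinity" .
  next
    assume "c > 0"
    have sq: "filterlim (\<lambda>r. (deriv u r)\<^sup>2) at_top at_top"
    proof (cases "deriv u 0 > 0")
      case True
      then have "filterlim (deriv u) at_top at_top"
        using \<open>c > 0\<close> u0 by (intro pos.shrinking_unbounded)
      then show ?thesis
        by (intro filterlim_pow_at_top) simp_all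
    next
      case False
      then have "filterlim (\<lambda>r. - deriv u r) at_top at_top"
        using \<open>c > 0\<close> u0 assms(3) by (intro neg.shrinking_unbounded) simp_all
      then have "filterlim (\<lambda>r. (- deriv u r)\<^sup>2) at_top at_top"
        by (intro filterlim_pow_at_top) simp_all
      then show ?thesis
        by simp
    qed
    have "filterlim (\<lambda>x::real^7. (deriv u (norm x))\<^sup>2) at_top at_infinity"
      by (rule filterlim_compose[OF sq filterlim_norm_at_top])
    then show "filterlim (torsion_norm_sq (radial_g2 u)) at_top at_infinity"
      by (rule filterlim_at_top_mono) (use T in eventually_elim, simp)
  qed
qed

end
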